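(* For $\vec{x}=(a,b,c,d,e,f,g)^T\in V$, $$S(f-e)\,A(1-a,e-a,f-a,g-a)\,K_{p_0}(\vec{x})+S(f-a)\,A(e-a,e-b,e-c,e-d)\,L_6(\vec{x})-S(e-a)\,A(f-a,f-b,f-c,f-d)\,L_5(\vec{x})=0.$$
   Context: $V=\{(a,b,c,d,e,f,g)^T\in\mathbb{C}^7: e+f+g-a-b-c-d=1\}$. ${}_4F_3\left[\begin{smallmatrix}a,b,c,d\\ e,f,g\end{smallmatrix};1\right]=\sum_{n\ge0}\frac{(a)_n(b)_n(c)_n(d)_n}{n!(e)_n(f)_n(g)_n}$, with $(a)_n$ the rising factorial. For $(a,b,c,d,e,f,g)^T\in V$, $$K(a;b,c,d;e,f,g)=\frac{{}_4F_3\left[\begin{smallmatrix}a,b,c,d\\ e,f,g\end{smallmatrix};1\right]}{\sin\pi a\,\Gamma(a)\Gamma(1+a-e)\Gamma(1+a-f)\Gamma(1+a-g)\Gamma(e)\Gamma(f)\Gamma(g)}+\frac{{}_4F_3\left[\begin{smallmatrix}a,1+a-e,1+a-f,1+a-g\\ 1+a-b,1+a-c,1+a-d\end{smallmatrix};1\right]}{\sin\pi a\,\Gamma(a)\Gamma(b)\Gamma(c)\Gamma(d)\Gamma(1+a-b)\Gamma(1+a-c)\Gamma(1+a-d)},$$ $$L(a,b,c,d;e;f,g)=\frac{{}_4F_3\left[\begin{smallmatrix}a,b,c,d\\ e,f,g\end{smallmatrix};1\right]}{\sin\pi e\,\Gamma(1+a-e)\Gamma(1+b-e)\Gamma(1+c-e)\Gamma(1+d-e)\Gamma(e)\Gamma(f)\Gamma(g)}-\frac{{}_4F_3\left[\begin{smallmatrix}1+a-e,1+b-e,1+c-e,1+d-e\\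 2-e,1+f-e,1+g-e\end{smallmatrix};1\right]}{\sin\pi e\,\Gamma(a)\Gamma(b)\Gamma(c)\Gamma(d)\Gamma(2-e)\Gamma(1+f-e)\Gamma(1+g-e)}.$$ Notation: $S(a_1,\dots,a_n)=\sin\pi a_1\cdots\sin\pi a_n$; $A(x,y,z,w)=\frac{1}{\Gamma(x)\Gamma(y)\Gamma(z)\Gamma(w)}$ (with $1/\Gamma=0$ at nonpositive integers). The relation is asserted for those $\vec{x}\in V$ at which the $K$ and $L$ functions occurring are defined (no lower parameter of an occurring series is a nonpositive integer, no sine in an occurring denominator vanishes). Here $K_{p_0}(\vec{x})=K(a;b,c,d;e,f,g)$, $L_6(\vec{x})=L(a,b,c,d;e;f,g)$, $L_5(\vec{x})=L(a,b,c,d;f;e,g)$. *)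

theory Defs
  imports "HOL-Analysis.Analysis"
begin

definition V :: "(complex^7) set" where
  "V = {x. x$5 + x$6 + x$7 - x$1 - x$2 - x$3 - x$4 = 1}"

text \<open>The series \<open>4F3(a,b,c,d; e,f,g; z)\<close> at \<open>z = 1\<close>. In all uses below the parametric excess
  \<open>e + f + g - a - b - c - d\<close> is \<open>1\<close>, so the series converges absolutely once no lower parameter is
  a nonpositive integer.\<close>

definition F43 ::
  "complex \<Rightarrow> complex \<Rightarrow> complex \<Rightarrow> complex \<Rightarrow> complex \<Rightarrow> complex \<Rightarrow> complex \<Rightarrow> complex" where
  "F43 a b c d e f g =
     (\<Sum>n. (pochhammer a n * pochhammer b n * pochhammer c n * pochhammer d n) /
          (fact n * pochhammer e n * pochhammer f n * pochhammer g n))"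

definition Sprod :: "complex list \<Rightarrow> complex" where
  "Sprod xs = (\<Prod>x\<leftarrow>xs. sin (of_real pi * x))"

definition Aprod :: "complex \<Rightarrow> complex \<Rightarrow> complex \<Rightarrow> complex \<Rightarrow> complex" where
  "Aprod x y z w = rGamma x * rGamma y * rGamma z * rGamma w"

text \<open>Gamma factors in denominators are written with \<^const>\<open>rGamma\<close>, the entire function \<open>1/\<Gamma>\<close>,
  which is \<open>0\<close> at the nonpositive integers.\<close>

definition Kfun ::
  "complex \<Rightarrow> complex \<Rightarrow> complex \<Rightarrow> complex \<Rightarrow> complex \<Rightarrow> complex \<Rightarrow> complex \<Rightarrow> complex" where
  "Kfun a b c d e f g =
     F43 a b c d e f g *
       (rGamma a * rGamma (1 + a - e) * rGamma (1 + a - f) * rGamma (1 + a - g) *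
        rGamma e * rGamma f * rGamma g) / sin (of_real pi * a)
   + F43 a (1 + a - e) (1 + a - f) (1 + a - g) (1 + a - b) (1 + a - c) (1 + a - d) *
       (rGamma a * rGamma b * rGamma c * rGamma d *
        rGamma (1 + a - b) * rGamma (1 + a - c) * rGamma (1 + a - d)) / sin (of_real pi * a)"

definition Lfun ::
  "complex \<Rightarrow> complex \<Rightarrow> complex \<Rightarrow> complex \<Rightarrow> complex \<Rightarrow> complex \<Rightarrow> complex \<Rightarrow> complex" where
  "Lfun a b c d e f g =
     F43 a b c d e f g *
       (rGamma (1 + a - e) * rGamma (1 + b - e) * rGamma (1 + c - e) * rGamma (1 + d - e) *
        rGamma e * rGamma f * rGamma g) / sin (of_real pi * e)
   - F43 (1 + a - e) (1 + b - e) (1 + c - e) (1 + d - e) (2 - e) (1 + f - e) (1 + g - e) *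
       (rGamma a * rGamma b * rGamma c * rGamma d *
        rGamma (2 - e) * rGamma (1 + f - e) * rGamma (1 + g - e)) / sin (of_real pi * e)"

text \<open>\<open>Kfun\<close> and \<open>Lfun\<close> are total, so the parameters at which the mathematical functions are defined
  are singled out separately: the sine in the denominator is nonzero and no lower parameter of either
  series is a nonpositive integer.\<close>

definition K_defined ::
  "complex \<Rightarrow> complex \<Rightarrow> complex \<Rightarrow> complex \<Rightarrow> complex \<Rightarrow> complex \<Rightarrow> complex \<Rightarrow> bool" where
  "K_defined a b c d e f g \<longleftrightarrow>
     sin (of_real pi * a) \<noteq> 0 \<and>
     {e, f, g, 1 + a - b, 1 + a - c, 1 + a - d} \<inter> \<int>\<^sub>\<le>\<^sub>0 = {}"

definition L_defined ::
  "complex \<Rightarrow> complex \<Rightarrow> complex \<Rightarrow> complex \<Rightarrow> complex \<Rightarrow> complex \<Rightarrow> complex \<Rightarrow> bool" where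
  "L_defined a b c d e f g \<longleftrightarrow>
     sin (of_real pi * e) \<noteq> 0 \<and>
     {e, f, g, 2 - e, 1 + f - e, 1 + g - e} \<inter> \<int>\<^sub>\<le>\<^sub>0 = {}"

definition K_p0 :: "complex^7 \<Rightarrow> complex" where
  "K_p0 x = Kfun (x$1) (x$2) (x$3) (x$4) (x$5) (x$6) (x$7)"

definition L6 :: "complex^7 \<Rightarrow> complex" where
  "L6 x = Lfun (x$1) (x$2) (x$3) (x$4) (x$5) (x$6) (x$7)"

definition L5 :: "complex^7 \<Rightarrow> complex" where
  "L5 x = Lfun (x$1) (x$2) (x$3) (x$4) (x$6) (x$5) (x$7)"

end

theory Submission
  imports Defs "HOL-Real_Asymp.Real_Asymp"
begin

text \<open>
  All four series are sums of residues of the single function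
  \<open>G(t) = \<Gamma>(a + t) \<Gamma>(-t) \<Gamma>(1 - e - t) \<Gamma>(1 - f - t) / (\<Gamma>(1 - b - t) \<Gamma>(1 - c - t) \<Gamma>(1 - d - t) \<Gamma>(g + t))\<close>,
  at the poles \<open>n\<close>, \<open>1 - e + n\<close>, \<open>1 - f + n\<close> and \<open>-a - n\<close>, and the total residue is \<open>0\<close>. To avoid estimating
  \<open>G\<close> on contours, each factor \<open>1/\<Gamma>(z)\<close> is truncated to a Pochhammer polynomial of degree about \<open>N\<close>. The
  residues of the resulting rational function sum to the leading coefficient \<open>\<plusminus>1\<close> of its numerator (Lagrange
  interpolation); after division by \<open>N\<close> this vanishes in the limit, and each term converges to a residue of
  \<open>G\<close>, so Tannery's theorem gives the four-term relation. The coefficients of \<open>4F3(a,b,c,d; e,f,g)\<close> are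
  matched by a trigonometric identity. If \<open>e - a\<close> or \<open>f - a\<close> is an integer the poles collide, but then the two
  series with nonzero coefficients terminate and are reversals of one another.
\<close>

subsection \<open>Asymptotics of Pochhammer symbols\<close>

text \<open>The truncation has \<open>4 * N\<close> simple poles and a numerator of degree
  \<open>4 * N - 1\<close>, so its residues sum to a number of norm \<open>1\<close>, not to
  \<open>0\<close>. The parametric excess \<open>1\<close> makes this harmless: because of it the
  \<open>n\<close>-th truncated residue is asymptotically \<open>N\<close> times a limit, and these
  limits are of order \<open>(n + 1) powr (-2)\<close>. Division by \<open>N\<close> therefore keeps
  every term finite and sends the total to \<open>0\<close>. The series
  \<open>F43 a b c d e f g\<close> occurs in \<open>Kfun\<close> and in both instances of
  \<open>Lfun\<close>, so its coefficient has three contributions; a trigonometric identity is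
  needed only there. Each of the other three series occurs once, and for it the reflection formula
  suffices. Coincidences of poles: the nonvanishing sines exclude integral \<open>a\<close>,
  \<open>e\<close>, \<open>f\<close>; the two \<open>L_defined\<close> conditions exclude a nonzero
  integral \<open>f - e\<close>; and for \<open>e = f\<close> the relation is trivial. No condition
  restrains \<open>e - a\<close> and \<open>f - a\<close>, which is why only these two need a
  separate argument.\<close>

definition fact_powr :: "nat \<Rightarrow> real \<Rightarrow> real" where
  "fact_powr m x = fact m * (real m + 1) powr x"

lemma fact_powr_pos [simp]: "fact_powr m x > 0"
  by (simp add: fact_powr_def)

lemma fact_powr_divide: "fact_powr m x / fact_powr m y = (real m + 1) powr (x - y)"
  by (simp add: fact_powr_def powr_diff)

lemma norm_rGamma_series:
  assumes "n > 0"
  shows "norm (rGamma_series (z::complex) n) = norm (pochhammer z (Suc n)) / (fact n * real n powr Re z)"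
  using assms by (simp add: rGamma_series_def norm_divide norm_mult powr_def)

text \<open>Gauss's limit for \<open>1/Gamma\<close>, reindexed because
  \<open>rGamma_series z n\<close> contains \<open>pochhammer z (Suc n)\<close>. The base
  \<open>m + 1\<close> in \<open>fact_powr\<close> keeps it positive at \<open>m = 0\<close>, so the
  bounds derived from this limit hold for all \<open>m\<close>.\<close>

lemma norm_pochhammer_asymp:
  "(\<lambda>m. norm (pochhammer (z::complex) m) / fact_powr m (Re z - 1)) \<longlonglongrightarrow> norm (rGamma z)"
proof (rule LIMSEQ_imp_Suc)
  have 1: "(\<lambda>n. real n powr Re z / ((real n + 1) * (real n + 2) powr (Re z - 1))) \<longlonglongrightarrow> 1"
    by real_asymp
  have "(\<lambda>n. norm (rGamma_series z n) * (real n powr Re z / ((real n + 1) * (real n + 2) powr (Re z - 1))))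
          \<longlonglongrightarrow> norm (rGamma z) * 1"
    by (intro tendsto_mult tendsto_norm rGamma_series_LIMSEQ 1)
  moreover have "eventually (\<lambda>n. norm (rGamma_series z n) * (real n powr Re z / ((real n + 1) * (real n + 2) powr (Re z - 1)))
      = norm (pochhammer z (Suc n)) / fact_powr (Suc n) (Re z - 1)) sequentially"
    using eventually_gt_at_top[of 0]
    by eventually_elim (simp add: norm_rGamma_series fact_powr_def field_simps del: pochhammer_Suc)
  ultimately show "(\<lambda>m. norm (pochhammer z (Suc m)) / fact_powr (Suc m) (Re z - 1)) \<longlonglongrightarrow> norm (rGamma z)"
    by (simp add: tendsto_cong)
qed

lemma norm_pochhammer_le:
  "\<exists>C>0. \<forall>m. norm (pochhammer (z::complex) m) \<le> C * fact_powr m (Re z - 1)"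
proof -
  have "Bseq (\<lambda>m. norm (pochhammer z m) / fact_powr m (Re z - 1))"
    using norm_pochhammer_asymp convergent_imp_Bseq convergentI by blast
  then obtain C where "C > 0" "\<And>m. norm (norm (pochhammer z m) / fact_powr m (Re z - 1)) \<le> C"
    by (auto simp: Bseq_def)
  then show ?thesis
    by (intro exI[of _ C]) (auto simp: field_simps abs_of_pos)
qed

text \<open>Off the nonpositive integers \<open>rGamma z\<close> is nonzero, so the reciprocal ratio
  converges too and is bounded.\<close>

lemma norm_pochhammer_ge:
  assumes "(z::complex) \<notin> \<int>\<^sub>\<le>\<^sub>0"
  shows "\<exists>C>0. \<forall>m. fact_powr m (Re z - 1) \<le> C * norm (pochhammer z m)"
proof -
  have nz: "pochhammer z m \<noteq> 0" for m
    using assms pochhammer_eq_0_imp_nonpos_Int by blast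
  have "(\<lambda>m. inverse (norm (pochhammer z m) / fact_powr m (Re z - 1))) \<longlonglongrightarrow> inverse (norm (rGamma z))"
    using assms by (intro tendsto_inverse norm_pochhammer_asymp) (auto simp: rGamma_eq_zero_iff)
  then have "Bseq (\<lambda>m. inverse (norm (pochhammer z m) / fact_powr m (Re z - 1)))"
    using convergent_imp_Bseq convergentI by blast
  then obtain C where "C > 0" "\<And>m. norm (inverse (norm (pochhammer z m) / fact_powr m (Re z - 1))) \<le> C"
    by (auto simp: Bseq_def)
  then show ?thesis
    using nz by (intro exI[of _ C]) (auto simp: field_simps abs_of_pos)
qed

lemma powr_Suc_bounds:
  fixes x :: real
  shows "(real m + 2) powr x \<le> 2 powr \<bar>x\<bar> * (real m + 1) powr x"
    and "(real m + 1) powr x \<le> 2 powr \<bar>x\<bar> * (real m + 2) powr x"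
proof -
  define q where "q = (real m + 2) / (real m + 1)"
  have q: "1 \<le> q" "q \<le> 2" by (auto simp: q_def field_simps)
  have e: "(real m + 2) powr x = q powr x * (real m + 1) powr x"
    by (simp add: q_def flip: powr_mult)
  have "q powr x \<le> q powr \<bar>x\<bar>" "q powr (-x) \<le> q powr \<bar>x\<bar>"  using q by (auto intro!: powr_mono)
  moreover have "q powr \<bar>x\<bar> \<le> 2 powr \<bar>x\<bar>" using q by (intro powr_mono2) auto
  ultimately have b: "q powr x \<le> 2 powr \<bar>x\<bar>" "q powr (-x) \<le> 2 powr \<bar>x\<bar>" by linarith+
  show "(real m + 2) powr x \<le> 2 powr \<bar>x\<bar> * (real m + 1) powr x"
    unfolding e using b by (intro mult_right_mono) auto
  have "1 \<le> 2 powr \<bar>x\<bar> * q powr x"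
    using b(2) q by (simp add: powr_minus field_simps)
  then have "1 * (real m + 1) powr x \<le> 2 powr \<bar>x\<bar> * q powr x * (real m + 1) powr x"
    by (intro mult_right_mono) auto
  then show "(real m + 1) powr x \<le> 2 powr \<bar>x\<bar> * (real m + 2) powr x"
    unfolding e by (simp add: mult_ac)
qed

text \<open>Since \<open>fact (m + j)\<close> is of order \<open>fact m * (m + 1) ^ j\<close>,
  lengthening by \<open>j\<close> amounts to raising the exponent by \<open>j\<close>. This absorbs
  the offsets \<open>s\<close> and \<open>t\<close> of the truncation lengths.\<close>

lemma fact_powr_shift:
  "\<exists>C>0. \<forall>m. fact_powr (m + j) x \<le> C * fact_powr m (x + real j) \<and>
             fact_powr m (x + real j) \<le> C * fact_powr (m + j) x"
proof (induction j arbitrary: x)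
  case 0
  show ?case by (intro exI[of _ 1]) auto
next
  case (Suc j)
  obtain C where C: "C > 0" "\<And>m. fact_powr (m + j) (x+1) \<le> C * fact_powr m (x + 1 + real j)"
     "\<And>m. fact_powr m (x + 1 + real j) \<le> C * fact_powr (m + j) (x+1)" using Suc[of "x+1"] by blast
  have 1: "fact_powr (Suc m) x \<le> 2 powr \<bar>x\<bar> * fact_powr m (x+1)"
          "fact_powr m (x+1) \<le> 2 powr \<bar>x\<bar> * fact_powr (Suc m) x" for m
  proof -
    have e: "fact_powr (Suc m) x = (fact m * (real m + 1)) * (real m + 2) powr x"
       "fact_powr m (x+1) = (fact m * (real m + 1)) * (real m + 1) powr x"
      by (simp_all add: fact_powr_def powr_add algebra_simps)
    have "(fact m * (real m + 1)) * (real m + 2) powr x \<le> (fact m * (real m + 1)) * (2 powr \<bar>x\<bar> * (real m + 1) powr x)"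
      by (intro mult_left_mono powr_Suc_bounds) auto
    then show "fact_powr (Suc m) x \<le> 2 powr \<bar>x\<bar> * fact_powr m (x+1)" unfolding e by (simp add: mult_ac)
    have "(fact m * (real m + 1)) * (real m + 1) powr x \<le> (fact m * (real m + 1)) * (2 powr \<bar>x\<bar> * (real m + 2) powr x)"
      by (intro mult_left_mono powr_Suc_bounds) auto
    then show "fact_powr m (x+1) \<le> 2 powr \<bar>x\<bar> * fact_powr (Suc m) x" unfolding e by (simp add: mult_ac)
  qed
  have "fact_powr (m + Suc j) x \<le> (2 powr \<bar>x\<bar> * C) * fact_powr m (x + real (Suc j))" for m
  proof -
    have "fact_powr (m + Suc j) x \<le> 2 powr \<bar>x\<bar> * fact_powr (m+j) (x+1)" using 1[of "m+j"] by simp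
    also have "\<dots> \<le> 2 powr \<bar>x\<bar> * (C * fact_powr m (x + 1 + real j))" by (intro mult_left_mono C) auto
    finally show ?thesis by (simp add: mult_ac add_ac)
  qed
  moreover have "fact_powr m (x + real (Suc j)) \<le> (2 powr \<bar>x\<bar> * C) * fact_powr (m + Suc j) x" for m
  proof -
    have "fact_powr m (x + real (Suc j)) \<le> C * fact_powr (m + j) (x+1)" using C(3)[of m] by (simp add: add_ac)
    also have "\<dots> \<le> C * (2 powr \<bar>x\<bar> * fact_powr (Suc (m+j)) x)" using C by (intro mult_left_mono 1) auto
    finally show ?thesis by (simp add: mult_ac)
  qed
  ultimately show ?case using C(1) by (intro exI[of _ "2 powr \<bar>x\<bar> * C"]) auto
qed

lemma tendsto_shift_ratio: "(\<lambda>N. (z + of_nat N) / of_nat N) \<longlonglongrightarrow> (1::complex)"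
proof -
  have "(\<lambda>N. z / of_nat N + 1) \<longlonglongrightarrow> 0 + 1"
    by (intro tendsto_intros lim_const_over_n)
  moreover have "eventually (\<lambda>N. z / of_nat N + 1 = (z + of_nat N) / of_nat N) sequentially"
    using eventually_gt_at_top[of 0] by eventually_elim (simp add: field_simps)
  ultimately show ?thesis by (simp add: tendsto_cong)
qed

text \<open>Norms do not suffice for the limits of the residues, so complex powers of
  \<open>N\<close> are kept here. Changing \<open>s\<close> by one multiplies or divides by
  \<open>(z + s + N) / N\<close>, which tends to \<open>1\<close>; hence the two-sided induction
  from Gauss's limit at \<open>s = 0\<close>.\<close>

lemma pochhammer_tendsto:
  fixes z :: complex and s :: int
  shows "(\<lambda>N. pochhammer z (nat (int N + s)) / (fact N * of_nat N powr (z - 1 + of_int s))) \<longlonglongrightarrow> rGamma z"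
proof (induction s rule: int_induct[where k = 0])
  case base
  have "(\<lambda>N. rGamma_series z N / ((z + of_nat N) / of_nat N)) \<longlonglongrightarrow> rGamma z / 1"
    by (intro tendsto_divide tendsto_shift_ratio rGamma_series_LIMSEQ) auto
  moreover have "eventually (\<lambda>N. rGamma_series z N / ((z + of_nat N) / of_nat N) =
      pochhammer z N / (fact N * of_nat N powr (z - 1))) sequentially"
    \<comment> \<open>For \<open>N\<close> beyond the norm of \<open>z\<close> the factor
      \<open>z + N\<close>, which is divided out, is nonzero.\<close>
    using eventually_gt_at_top[of "nat \<lceil>norm z\<rceil>"]
  proof eventually_elim
    case (elim N)
    then have N: "N > 0" by auto
    have nz: "z + of_nat N \<noteq> 0"
    proof
      assume "z + of_nat N = 0"
      then have "z = - of_nat N" by (simp add: add_eq_0_iff2)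
      then have "norm z = real N" by simp
      then show False using elim by simp
    qed
    have "of_nat N powr (z - 1) = exp (z * of_real (ln (of_nat N))) / of_nat N"
      using N by (simp add: powr_def powr_diff left_diff_distrib exp_diff Ln_of_nat exp_of_real)
    then show ?case using N nz
      by (simp add: rGamma_series_def pochhammer_Suc add_eq_0_iff2 mult_ac)
  qed
  ultimately show ?case by (simp add: tendsto_cong)
next
  case (step1 i)
  have "(\<lambda>N. pochhammer z (nat (int N + i)) / (fact N * of_nat N powr (z - 1 + of_int i)) *
           ((z + of_int i + of_nat N) / of_nat N)) \<longlonglongrightarrow> rGamma z * 1"
    by (intro tendsto_mult step1 tendsto_shift_ratio)
  moreover have "eventually (\<lambda>N. pochhammer z (nat (int N + i)) / (fact N * of_nat N powr (z - 1 + of_int i)) *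
           ((z + of_int i + of_nat N) / of_nat N) = 
      pochhammer z (nat (int N + (i+1))) / (fact N * of_nat N powr (z - 1 + of_int (i+1)))) sequentially"
    using eventually_gt_at_top[of "nat (-i)"] eventually_gt_at_top[of 0]
  proof eventually_elim
    case (elim N)
    have e: "nat (int N + (i + 1)) = Suc (nat (int N + i))" using elim by simp
    have c: "of_nat (nat (int N + i)) = (of_int i + of_nat N :: complex)"
      using elim by (subst of_nat_nat) auto
    show ?case unfolding e pochhammer_Suc c
      using elim by (simp add: powr_add add_ac powr_diff field_simps)
  qed
  ultimately show ?case by (simp add: tendsto_cong)
next
  case (step2 i)
  have "(\<lambda>N. pochhammer z (nat (int N + i)) / (fact N * of_nat N powr (z - 1 + of_int i)) /
           ((z + of_int (i-1) + of_nat N) / of_nat N)) \<longlonglongrightarrow> rGamma z / 1"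
    by (intro tendsto_divide step2 tendsto_shift_ratio) auto
  moreover have "eventually (\<lambda>N. pochhammer z (nat (int N + i)) / (fact N * of_nat N powr (z - 1 + of_int i)) /
           ((z + of_int (i-1) + of_nat N) / of_nat N) = 
      pochhammer z (nat (int N + (i-1))) / (fact N * of_nat N powr (z - 1 + of_int (i-1)))) sequentially"
    using eventually_gt_at_top[of "nat (-i) + 1"] eventually_gt_at_top[of 0]
      eventually_gt_at_top[of "nat \<lceil>norm (z + of_int (i-1))\<rceil>"]
  proof eventually_elim
    case (elim N)
    have e: "nat (int N + i) = Suc (nat (int N + (i - 1)))" using elim by simp
    have c: "of_nat (nat (int N + (i-1))) = (of_int (i-1) + of_nat N :: complex)"
      using elim by (subst of_nat_nat) auto
    have nz: "(z + of_int (i-1)) + of_nat N \<noteq> 0"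
    proof
      assume "(z + of_int (i-1)) + of_nat N = 0"
      then have "z + of_int (i-1) = - of_nat N" by (simp only: add_eq_0_iff2)
      then have "norm (z + of_int (i-1)) = real N" by simp
      then show False using elim(3) by simp
    qed
    have p: "of_nat N powr (z - 1 + of_int i) = of_nat N powr (z - 1 + of_int (i-1)) * (of_nat N :: complex)"
      using elim by (simp add: powr_add powr_diff field_simps power2_eq_square)
    define q where "q = z + of_int (i-1) + of_nat N"
    have q: "z + (of_int (i-1) + of_nat N) = q" by (simp add: q_def add.assoc)
    show ?case unfolding e pochhammer_Suc c p q q_def[symmetric]
      using elim nz unfolding q_def[symmetric] by simp
  qed
  ultimately show ?case by (simp add: tendsto_cong)
qed

text \<open>
  \<open>F N n\<close> is the \<open>n\<close>-th residue of the \<open>N\<close>-th truncation. The bound keeps track of the powers of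
  \<open>n + 1\<close>, \<open>N - n + 1\<close> and \<open>N + 1\<close> separately, so that the predicate is multiplicative.
\<close>

definition growth :: "(nat \<Rightarrow> nat \<Rightarrow> complex) \<Rightarrow> (nat \<Rightarrow> complex) \<Rightarrow> complex \<Rightarrow>
    real \<Rightarrow> real \<Rightarrow> real \<Rightarrow> bool" where
  "growth F l d \<alpha> \<beta> \<gamma> \<longleftrightarrow>
     (\<forall>n. (\<lambda>N. F N n / of_nat N powr d) \<longlonglongrightarrow> l n) \<and>
     (\<exists>C n\<^sub>0. \<forall>n\<ge>n\<^sub>0. \<forall>N>n. norm (F N n) \<le>
        C * ((real n + 1) powr \<alpha> * (real (N - n) + 1) powr \<beta> * (real N + 1) powr \<gamma>))"

lemma growth_mult:
  assumes "growth F l d \<alpha> \<beta> \<gamma>" "growth F' l' d' \<alpha>' \<beta>' \<gamma>'"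
  shows "growth (\<lambda>N n. F N n * F' N n) (\<lambda>n. l n * l' n) (d + d') (\<alpha> + \<alpha>') (\<beta> + \<beta>') (\<gamma> + \<gamma>')"
proof -
  have "(\<lambda>N. F N n * F' N n / of_nat N powr (d + d')) \<longlonglongrightarrow> l n * l' n" for n
  proof -
    have "(\<lambda>N. F N n / of_nat N powr d * (F' N n / of_nat N powr d')) \<longlonglongrightarrow> l n * l' n"
      using assms by (intro tendsto_mult) (auto simp: growth_def)
    then show ?thesis by (simp add: powr_add)
  qed
  moreover obtain C n\<^sub>0 where C: "\<And>n N. n \<ge> n\<^sub>0 \<Longrightarrow> N > n \<Longrightarrow> norm (F N n) \<le>
        C * ((real n + 1) powr \<alpha> * (real (N - n) + 1) powr \<beta> * (real N + 1) powr \<gamma>)"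
    using assms(1) unfolding growth_def by blast
  moreover obtain C' n\<^sub>0' where C': "\<And>n N. n \<ge> n\<^sub>0' \<Longrightarrow> N > n \<Longrightarrow> norm (F' N n) \<le>
        C' * ((real n + 1) powr \<alpha>' * (real (N - n) + 1) powr \<beta>' * (real N + 1) powr \<gamma>')"
    using assms(2) unfolding growth_def by blast
  have "norm (F N n * F' N n) \<le>
        C * C' * ((real n + 1) powr (\<alpha> + \<alpha>') * (real (N - n) + 1) powr (\<beta> + \<beta>') * (real N + 1) powr (\<gamma> + \<gamma>'))"
    if n: "n \<ge> max n\<^sub>0 n\<^sub>0'" "N > n" for n N
  proof -
    have "norm (F N n) * norm (F' N n) \<le>
       (C * ((real n + 1) powr \<alpha> * (real (N - n) + 1) powr \<beta> * (real N + 1) powr \<gamma>)) *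
       (C' * ((real n + 1) powr \<alpha>' * (real (N - n) + 1) powr \<beta>' * (real N + 1) powr \<gamma>'))"
      using n by (intro mult_mono' C C') auto
    then show ?thesis by (simp add: norm_mult powr_add mult_ac)
  qed
  ultimately show ?thesis unfolding growth_def by blast
qed

text \<open>For \<open>\<beta> \<ge> 0\<close> the power of \<open>N - n + 1\<close> is at most that
  of \<open>N + 1\<close>, so all dependence on \<open>N\<close> collapses to one factor
  \<open>N + 1\<close>. Division by \<open>N\<close> leaves a multiple of
  \<open>(n + 1) powr (-2)\<close>, a summable bound independent of \<open>N\<close>, as Tannery's
  theorem demands.\<close>

lemma growth_sum_tendsto:
  assumes F: "growth F l 1 (-2) \<beta> (1 - \<beta>)" and "\<beta> \<ge> 0"
  shows "summable l" and "(\<lambda>N. (\<Sum>n<N. F N n) / of_nat N) \<longlonglongrightarrow> suminf l"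
proof -
  define A where "A n N = (if n < N then F N n / of_nat N else 0)" for n N
  obtain C n\<^sub>0 where C: "\<And>n N. n \<ge> n\<^sub>0 \<Longrightarrow> N > n \<Longrightarrow> norm (F N n) \<le>
        C * ((real n + 1) powr (-2) * (real (N - n) + 1) powr \<beta> * (real N + 1) powr (1 - \<beta>))"
    using F unfolding growth_def by blast
  have bound: "norm (A n N) \<le> 2 * \<bar>C\<bar> * (real (Suc n) powr (-2))" if "n \<ge> n\<^sub>0" for n N
  proof (cases "n < N")
    case True
    have "norm (F N n) \<le> C * ((real n + 1) powr (-2) * (real (N - n) + 1) powr \<beta> * (real N + 1) powr (1 - \<beta>))"
      using C that True by blast
    also have "\<dots> \<le> \<bar>C\<bar> * ((real n + 1) powr (-2) * (real (N - n) + 1) powr \<beta> * (real N + 1) powr (1 - \<beta>))"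
      by (intro mult_right_mono) auto
    also have "\<dots> \<le> \<bar>C\<bar> * ((real n + 1) powr (-2) * (real N + 1) powr \<beta> * (real N + 1) powr (1 - \<beta>))"
      using \<open>\<beta> \<ge> 0\<close> by (intro mult_left_mono mult_right_mono powr_mono2) auto
    also have "\<dots> = \<bar>C\<bar> * (real n + 1) powr (-2) * (real N + 1)"
      by (simp add: powr_diff)
    also have "\<dots> \<le> \<bar>C\<bar> * (real n + 1) powr (-2) * (2 * real N)"
      using True by (intro mult_left_mono) auto
    finally show ?thesis
      using True by (simp add: A_def norm_divide field_simps)
  qed (auto simp: A_def)
  have lim: "(\<lambda>N. A n N) \<longlonglongrightarrow> l n" for n
  proof -
    have "(\<lambda>N. F N n / of_nat N powr 1) \<longlonglongrightarrow> l n" using F by (simp add: growth_def)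
    moreover have "eventually (\<lambda>N. F N n / of_nat N powr 1 = A n N) sequentially"
      using eventually_gt_at_top[of n] by eventually_elim (auto simp: A_def)
    ultimately show ?thesis by (simp add: tendsto_cong)
  qed
  have "eventually (\<lambda>(n, N). norm (A n N) \<le> 2 * \<bar>C\<bar> * (real (Suc n) powr (-2))) (at_top \<times>\<^sub>F at_top)"
    using eventually_prodI[OF eventually_ge_at_top[of n\<^sub>0] eventually_True]
    by (rule eventually_mono) (use bound in auto)
  moreover have "summable (\<lambda>n. 2 * \<bar>C\<bar> * (real (Suc n) powr (-2)))"
    by (intro summable_mult) (subst summable_Suc_iff, simp add: summable_real_powr_iff)
  ultimately have T: "summable (\<lambda>n. norm (l n))" "(\<lambda>N. \<Sum>n. A n N) \<longlonglongrightarrow> suminf l"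
    using tannerys_theorem[of A l sequentially, OF lim] by auto
  show "summable l" using T(1) by (rule summable_norm_cancel)
  have "(\<Sum>n. A n N) = (\<Sum>n<N. F N n) / of_nat N" for N
  proof -
    have "(\<Sum>n. A n N) = (\<Sum>n<N. A n N)" by (rule suminf_finite) (auto simp: A_def)
    then show ?thesis by (simp add: A_def sum_divide_distrib)
  qed
  then show "(\<lambda>N. (\<Sum>n<N. F N n) / of_nat N) \<longlonglongrightarrow> suminf l" using T(2) by simp
qed

section \<open>Bounds for Pochhammer symbols with arguments shifted by n\<close>

text \<open>The first \<open>n\<close> factors lie below \<open>u\<close>; negated and read
  backwards they form \<open>pochhammer (1 - u) n\<close>. The others start at
  \<open>u\<close>.\<close>

lemma pochhammer_diff_of_nat:
  fixes u :: "'a :: comm_ring_1"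
  assumes "n \<le> K"
  shows "pochhammer (u - of_nat n) K = (-1) ^ n * pochhammer (1 - u) n * pochhammer u (K - n)"
proof -
  have "pochhammer (u - of_nat n) n = (-1) ^ n * pochhammer (1 - u) n"
    using pochhammer_minus[of "of_nat n - u" n] by (simp add: algebra_simps)
  then show ?thesis using pochhammer_product[OF assms, of "u - of_nat n"] by simp
qed

text \<open>The symbol is split into a part of length about \<open>n\<close> and one of length about
  \<open>N - n\<close>, each bounded on its own. Where to split depends on the sign of
  \<open>s\<close>, since for \<open>s < 0\<close> the total length may fall below
  \<open>n\<close>.\<close>

lemma norm_pochhammer_diff_le:
  fixes u :: complex and s :: int
  shows "\<exists>C>0. \<exists>n\<^sub>0. \<forall>n\<ge>n\<^sub>0. \<forall>N>n. norm (pochhammer (u - of_nat n) (nat (int N + s)))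
      \<le> C * (fact_powr n (- Re u) * fact_powr (N - n) (Re u - 1 + of_int s))"
proof (cases "s \<ge> 0")
  case True
  define j where "j = nat s"
  have j: "s = int j" using True by (simp add: j_def)
  obtain C1 where C1: "C1 > 0" "\<And>m. norm (pochhammer (1 - u) m) \<le> C1 * fact_powr m (- Re u)"
    using norm_pochhammer_le[of "1 - u"] by auto
  obtain C2 where C2: "C2 > 0" "\<And>m. norm (pochhammer u m) \<le> C2 * fact_powr m (Re u - 1)"
    using norm_pochhammer_le[of u] by auto
  obtain C3 where C3: "C3 > 0" "\<And>m. fact_powr (m + j) (Re u - 1) \<le> C3 * fact_powr m (Re u - 1 + of_nat j)"
    using fact_powr_shift[of j "Re u - 1"] by auto
  have "norm (pochhammer (u - of_nat n) (nat (int N + s)))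
      \<le> C1 * (C2 * C3) * (fact_powr n (- Re u) * fact_powr (N - n) (Re u - 1 + of_int s))" if "N > n" for n N
  proof -
    have "norm (pochhammer (u - of_nat n) (nat (int N + s))) =
        norm (pochhammer (1 - u) n) * norm (pochhammer u ((N - n) + j))"
      using that j by (simp add: pochhammer_diff_of_nat norm_mult norm_power nat_int_add add_ac)
    also have "\<dots> \<le> (C1 * fact_powr n (- Re u)) * (C2 * (C3 * fact_powr (N - n) (Re u - 1 + of_nat j)))"
      using C2 by (intro mult_mono' C1 order.trans[OF C2(2)] mult_left_mono C3) auto
    finally show ?thesis using j by (simp add: mult_ac)
  qed
  then show ?thesis using C1 C2 C3
    by (intro exI[of _ "C1 * (C2 * C3)"]) auto
next
  case False
  define j where "j = nat (-s)"
  have j: "s = - int j" using False by (simp add: j_def)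
  obtain C1 where C1: "C1 > 0" "\<And>m. norm (pochhammer (1 - (u - of_nat j)) m) \<le> C1 * fact_powr m (- Re u + real j)"
    using norm_pochhammer_le[of "1 - (u - of_nat j)"] by auto
  obtain C2 where C2: "C2 > 0" "\<And>m. norm (pochhammer (u - of_nat j) m) \<le> C2 * fact_powr m (Re u - 1 + of_int s)"
    using norm_pochhammer_le[of "u - of_nat j"] by (auto simp: j algebra_simps)
  obtain C3 where C3: "C3 > 0" "\<And>m. fact_powr m (- Re u + of_nat j) \<le> C3 * fact_powr (m + j) (- Re u)"
    using fact_powr_shift[of j "- Re u"] by auto
  have "norm (pochhammer (u - of_nat n) (nat (int N + s)))
      \<le> C1 * (C2 * C3) * (fact_powr n (- Re u) * fact_powr (N - n) (Re u - 1 + of_int s))" if "n \<ge> j" "N > n" for n N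
  proof -
    \<comment> \<open>Splitting at \<open>u - j\<close> instead of \<open>u\<close> leaves exactly
      \<open>N - n\<close> factors in the upper part and needs only
      \<open>n - j \<le> N - j\<close>; hence the threshold \<open>n \<ge> j\<close>.\<close>
    have "pochhammer (u - of_nat n) (nat (int N + s)) = pochhammer (u - of_nat j - of_nat (n - j)) (N - j)"
      using that j by (simp add: of_nat_diff nat_diff_distrib')
    also have "\<dots> = (-1) ^ (n - j) * pochhammer (1 - (u - of_nat j)) (n - j) * pochhammer (u - of_nat j) (N - n)"
      using that by (subst pochhammer_diff_of_nat) auto
    finally have "norm (pochhammer (u - of_nat n) (nat (int N + s))) =
        norm (pochhammer (1 - (u - of_nat j)) (n - j)) * norm (pochhammer (u - of_nat j) (N - n))"
      by (simp add: norm_mult norm_power)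
    also have "\<dots> \<le> (C1 * (C3 * fact_powr (n - j + j) (- Re u))) * (C2 * fact_powr (N - n) (Re u - 1 + of_int s))"
      using C1 by (intro mult_mono' C2 order.trans[OF C1(2)] mult_left_mono C3) auto
    finally show ?thesis using that by (simp add: mult_ac)
  qed
  then show ?thesis using C1 C2 C3
    by (intro exI[of _ "C1 * (C2 * C3)"] conjI exI[of _ j]) auto
qed

text \<open>Both halves of the split need a lower bound, so neither \<open>w\<close> nor
  \<open>1 - w\<close> may be a nonpositive integer; nonintegrality of \<open>w\<close> gives
  both.\<close>

lemma norm_pochhammer_diff_ge:
  assumes "(w::complex) \<notin> \<int>"
  shows "\<exists>C>0. \<forall>n. \<forall>N>n. fact_powr n (- Re w) * fact_powr (N - n) (Re w - 1)
            \<le> C * norm (pochhammer (w - of_nat n) N)"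
proof -
  have w: "w \<notin> \<int>\<^sub>\<le>\<^sub>0" "1 - w \<notin> \<int>\<^sub>\<le>\<^sub>0"
    using assms nonpos_Ints_Int by (blast, metis Ints_1 Ints_diff diff_diff_eq2 add_diff_cancel_left' nonpos_Ints_Int)
  obtain C1 where C1: "C1 > 0" "\<And>m. fact_powr m (- Re w) \<le> C1 * norm (pochhammer (1 - w) m)"
    using norm_pochhammer_ge[OF w(2)] by auto
  obtain C2 where C2: "C2 > 0" "\<And>m. fact_powr m (Re w - 1) \<le> C2 * norm (pochhammer w m)"
    using norm_pochhammer_ge[OF w(1)] by auto
  have "fact_powr n (- Re w) * fact_powr (N - n) (Re w - 1) \<le> (C1 * C2) * norm (pochhammer (w - of_nat n) N)"
    if "n < N" for n N
  proof -
    have "fact_powr n (- Re w) * fact_powr (N - n) (Re w - 1)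
       \<le> (C1 * norm (pochhammer (1 - w) n)) * (C2 * norm (pochhammer w (N - n)))"
      by (intro mult_mono' C1 C2) (auto simp: less_imp_le)
    then show ?thesis using that by (simp add: pochhammer_diff_of_nat norm_mult norm_power mult_ac)
  qed
  then show ?thesis using C1 C2 by (intro exI[of _ "C1 * C2"]) auto
qed

text \<open>The symbol is the quotient of \<open>pochhammer v (n + K)\<close> by
  \<open>pochhammer v n\<close>, with \<open>K\<close> its length, so an upper and a lower bound
  combine.\<close>

lemma norm_pochhammer_add_le:
  assumes "(v::complex) \<notin> \<int>\<^sub>\<le>\<^sub>0"
  shows "\<exists>C>0. \<exists>n\<^sub>0. \<forall>n\<ge>n\<^sub>0. \<forall>N>n. norm (pochhammer (v + of_nat n) (nat (int N + s)))
      \<le> C * (fact_powr (n + N) (Re v - 1 + of_int s) / fact_powr n (Re v - 1))"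
proof -
  have nz: "pochhammer v n \<noteq> 0" for n
    using assms pochhammer_eq_0_imp_nonpos_Int by blast
  obtain C1 where C1: "C1 > 0" "\<And>m. fact_powr m (Re v - 1) \<le> C1 * norm (pochhammer v m)"
    using norm_pochhammer_ge[OF assms] by auto
  obtain C2 where C2: "C2 > 0" "\<And>m. norm (pochhammer v m) \<le> C2 * fact_powr m (Re v - 1)"
    using norm_pochhammer_le[of v] by auto
  \<comment> \<open>With \<open>N > n\<close> and \<open>n \<ge> nat (-s)\<close> the length
    \<open>N + s\<close> is not cut off by \<open>nat\<close>. The two signs of \<open>s\<close> use
    opposite directions of \<open>fact_powr_shift\<close>.\<close>
  obtain C3 where C3: "C3 > 0" "\<And>n N. n \<ge> nat (-s) \<Longrightarrow> N > n \<Longrightarrow>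
     fact_powr (n + nat (int N + s)) (Re v - 1) \<le> C3 * fact_powr (n + N) (Re v - 1 + of_int s)"
  proof (cases "s \<ge> 0")
    case True
    obtain C3 where "C3 > 0" "\<And>m. fact_powr (m + nat s) (Re v - 1) \<le> C3 * fact_powr m (Re v - 1 + of_nat (nat s))"
      using fact_powr_shift[of "nat s" "Re v - 1"] by auto
    then show ?thesis using that[of C3] True by (simp add: nat_int_add nat_add_distrib flip: add.assoc)
  next
    case False
    obtain C3 where C3: "C3 > 0" "\<And>m. fact_powr m (Re v - 1 + of_int s + of_nat (nat (-s))) \<le>
        C3 * fact_powr (m + nat (-s)) (Re v - 1 + of_int s)"
      using fact_powr_shift[of "nat (-s)" "Re v - 1 + of_int s"] by auto
    show ?thesis
    proof (rule that[OF C3(1)])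
      fix n N assume "n \<ge> nat (-s)" "N > n"
      then have e: "n + N = (n + nat (int N + s)) + nat (-s)" using False by simp
      show "fact_powr (n + nat (int N + s)) (Re v - 1) \<le> C3 * fact_powr (n + N) (Re v - 1 + of_int s)"
        unfolding e using C3(2)[of "n + nat (int N + s)"] False by simp
    qed
  qed
  have "norm (pochhammer (v + of_nat n) (nat (int N + s)))
      \<le> (C1 * C2 * C3) * (fact_powr (n + N) (Re v - 1 + of_int s) / fact_powr n (Re v - 1))"
    if "n \<ge> nat (-s)" "N > n" for n N
  proof -
    have "fact_powr n (Re v - 1) * norm (pochhammer (v + of_nat n) (nat (int N + s)))
        \<le> (C1 * norm (pochhammer v n)) * norm (pochhammer (v + of_nat n) (nat (int N + s)))"
      by (intro mult_right_mono C1) auto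
    also have "\<dots> = C1 * norm (pochhammer v (n + nat (int N + s)))"
      by (simp add: pochhammer_product' norm_mult)
    also have "\<dots> \<le> C1 * (C2 * (C3 * fact_powr (n + N) (Re v - 1 + of_int s)))"
      using C1 C2 that by (intro mult_left_mono order.trans[OF C2(2)] C3) auto
    finally show ?thesis by (simp add: field_simps)
  qed
  then show ?thesis using C1 C2 C3
    by (intro exI[of _ "C1 * C2 * C3"] conjI exI[of _ "nat (-s)"]) auto
qed

lemma norm_pochhammer_add_ge:
  assumes "(z::complex) \<notin> \<int>\<^sub>\<le>\<^sub>0"
  shows "\<exists>C>0. \<forall>n N. fact_powr (n + N) (Re z - 1) / fact_powr n (Re z - 1)
             \<le> C * norm (pochhammer (z + of_nat n) N)"
proof -
  obtain C1 where C1: "C1 > 0" "\<And>m. fact_powr m (Re z - 1) \<le> C1 * norm (pochhammer z m)"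
    using norm_pochhammer_ge[OF assms] by auto
  obtain C2 where C2: "C2 > 0" "\<And>m. norm (pochhammer z m) \<le> C2 * fact_powr m (Re z - 1)"
    using norm_pochhammer_le[of z] by auto
  have "fact_powr (n + N) (Re z - 1) / fact_powr n (Re z - 1) \<le> (C1 * C2) * norm (pochhammer (z + of_nat n) N)" for n N
  proof -
    have "fact_powr (n + N) (Re z - 1) \<le> C1 * (norm (pochhammer z n) * norm (pochhammer (z + of_nat n) N))"
      using C1(2)[of "n + N"] by (simp add: pochhammer_product' norm_mult)
    also have "\<dots> \<le> C1 * ((C2 * fact_powr n (Re z - 1)) * norm (pochhammer (z + of_nat n) N))"
      using C1 by (intro mult_left_mono mult_right_mono C2) auto
    finally show ?thesis by (simp add: field_simps)
  qed
  then show ?thesis using C1 C2 by (intro exI[of _ "C1 * C2"]) auto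
qed

section \<open>Growth of the individual factors of a residue\<close>

text \<open>For \<open>n < N\<close> the numbers \<open>n + N + 1\<close> and \<open>N + 1\<close>
  differ by a factor of at most \<open>2\<close>. This is why \<open>growth\<close> needs no
  separate exponent for \<open>n + N\<close>.\<close>

lemma powr_add_bound:
  "n < N \<Longrightarrow> (real (n + N) + 1) powr x \<le> 2 powr \<bar>x\<bar> * (real N + 1) powr x"
proof -
  assume "n < N"
  define q where "q = (real (n + N) + 1) / (real N + 1)"
  have q: "1 \<le> q" "q \<le> 2" using \<open>n < N\<close> by (auto simp: q_def field_simps)
  have e: "(real (n + N) + 1) powr x = q powr x * (real N + 1) powr x"
    by (simp add: q_def flip: powr_mult)
  have "q powr x \<le> q powr \<bar>x\<bar>" using q by (auto intro!: powr_mono)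
  also have "q powr \<bar>x\<bar> \<le> 2 powr \<bar>x\<bar>" using q by (intro powr_mono2) auto
  finally show ?thesis unfolding e by (intro mult_right_mono) auto
qed

lemma ratio_tendsto:
  fixes u w :: complex and s t :: int
  assumes "w \<notin> \<int>\<^sub>\<le>\<^sub>0" "d = u - w + of_int s - of_int t"
  shows "(\<lambda>N. pochhammer u (nat (int N + s)) / pochhammer w (nat (int N + t)) / of_nat N powr d)
            \<longlonglongrightarrow> rGamma u / rGamma w"
proof -
  have "(\<lambda>N. (pochhammer u (nat (int N + s)) / (fact N * of_nat N powr (u - 1 + of_int s))) /
             (pochhammer w (nat (int N + t)) / (fact N * of_nat N powr (w - 1 + of_int t))))
           \<longlonglongrightarrow> rGamma u / rGamma w"
    using assms by (intro tendsto_divide pochhammer_tendsto) (auto simp: rGamma_eq_zero_iff)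
  moreover have "eventually (\<lambda>N. (pochhammer u (nat (int N + s)) / (fact N * of_nat N powr (u - 1 + of_int s))) /
             (pochhammer w (nat (int N + t)) / (fact N * of_nat N powr (w - 1 + of_int t))) =
      pochhammer u (nat (int N + s)) / pochhammer w (nat (int N + t)) / of_nat N powr d) sequentially"
    using eventually_gt_at_top[of 0]
  proof eventually_elim
    case (elim N)
    have "d = (u - 1 + of_int s) - (w - 1 + of_int t)" using assms by simp
    then have "of_nat N powr d = (of_nat N powr (u - 1 + of_int s) / of_nat N powr (w - 1 + of_int t) :: complex)"
      by (simp only: powr_diff)
    then show ?case by simp
  qed
  ultimately show ?thesis by (simp add: tendsto_cong)
qed

lemma diff_of_nat_notin_nonpos_Ints:
  "(w::complex) \<notin> \<int> \<Longrightarrow> w - of_nat n \<notin> \<int>\<^sub>\<le>\<^sub>0"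
  by (metis Ints_add Ints_of_nat diff_add_cancel nonpos_Ints_Int)

lemma add_of_nat_notin_nonpos_Ints:
  "(z::complex) \<notin> \<int>\<^sub>\<le>\<^sub>0 \<Longrightarrow> z + of_nat n \<notin> \<int>\<^sub>\<le>\<^sub>0"
  using nonpos_Ints_diff_Nats[of "z + of_nat n" "of_nat n"] by auto

text \<open>Numerator and denominator have the same length, so the factorials of \<open>n\<close>
  and of \<open>N - n\<close> in their bounds cancel and only powers remain.\<close>

lemma growth_ratio_diff:
  assumes "(w::complex) \<notin> \<int>"
  shows "growth (\<lambda>N n. pochhammer (u - of_nat n) N / pochhammer (w - of_nat n) N)
           (\<lambda>n. rGamma (u - of_nat n) / rGamma (w - of_nat n)) (u - w) (Re w - Re u) (Re u - Re w) 0"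
  unfolding growth_def
proof (intro conjI allI)
  fix n
  show "(\<lambda>N. pochhammer (u - of_nat n) N / pochhammer (w - of_nat n) N / of_nat N powr (u - w))
          \<longlonglongrightarrow> rGamma (u - of_nat n) / rGamma (w - of_nat n)"
    using ratio_tendsto[OF diff_of_nat_notin_nonpos_Ints[OF assms, of n], of "u - w" "u - of_nat n" 0 0] by simp
next
  obtain C1 n\<^sub>0 where C1: "C1 > 0" "\<And>n N. n \<ge> n\<^sub>0 \<Longrightarrow> N > n \<Longrightarrow> norm (pochhammer (u - of_nat n) N)
      \<le> C1 * (fact_powr n (- Re u) * fact_powr (N - n) (Re u - 1))"
    using norm_pochhammer_diff_le[of u 0] by auto
  obtain C2 where C2: "C2 > 0" "\<And>n N. N > n \<Longrightarrow> fact_powr n (- Re w) * fact_powr (N - n) (Re w - 1)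
            \<le> C2 * norm (pochhammer (w - of_nat n) N)"
    using norm_pochhammer_diff_ge[OF assms] by auto
  have "norm (pochhammer (u - of_nat n) N / pochhammer (w - of_nat n) N) \<le> (C1 * C2) *
     ((real n + 1) powr (Re w - Re u) * (real (N - n) + 1) powr (Re u - Re w) * (real N + 1) powr 0)"
    if "n \<ge> n\<^sub>0" "N > n" for n N
  proof -
    define P where "P = fact_powr n (- Re w) * fact_powr (N - n) (Re w - 1)"
    have P: "P > 0" by (simp add: P_def)
    have nz: "norm (pochhammer (w - of_nat n) N) > 0"
      using C2(2)[OF that(2)] P C2(1) unfolding P_def by (smt (verit) mult_eq_0_iff norm_ge_zero)
    have "norm (pochhammer (u - of_nat n) N / pochhammer (w - of_nat n) N)
       \<le> C1 * (fact_powr n (- Re u) * fact_powr (N - n) (Re u - 1)) / (P / C2)"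
      unfolding norm_divide using C1 C2(1) that P nz C2(2)[OF that(2)]
      by (intro frac_le C1) (auto simp: field_simps P_def less_imp_le)
    also have "\<dots> = (C1 * C2) * ((fact_powr n (- Re u) / fact_powr n (- Re w)) *
        (fact_powr (N - n) (Re u - 1) / fact_powr (N - n) (Re w - 1)))"
      by (simp add: P_def)
    also have "\<dots> = (C1 * C2) *
     ((real n + 1) powr (Re w - Re u) * (real (N - n) + 1) powr (Re u - Re w) * (real N + 1) powr 0)"
      by (simp add: fact_powr_divide)
    finally show ?thesis .
  qed
  then show "\<exists>C n\<^sub>0. \<forall>n\<ge>n\<^sub>0. \<forall>N>n. norm (pochhammer (u - of_nat n) N / pochhammer (w - of_nat n) N) \<le> C *
     ((real n + 1) powr (Re w - Re u) * (real (N - n) + 1) powr (Re u - Re w) * (real N + 1) powr 0)"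
    by blast
qed

lemma growth_ratio_add:
  assumes "(v::complex) \<notin> \<int>\<^sub>\<le>\<^sub>0" "(z::complex) \<notin> \<int>\<^sub>\<le>\<^sub>0"
  shows "growth (\<lambda>N n. pochhammer (v + of_nat n) (nat (int N + s)) / pochhammer (z + of_nat n) N)
           (\<lambda>n. rGamma (v + of_nat n) / rGamma (z + of_nat n)) (v - z + of_int s)
           (Re z - Re v) 0 (Re v - Re z + of_int s)"
  unfolding growth_def
proof (intro conjI allI)
  fix n
  show "(\<lambda>N. pochhammer (v + of_nat n) (nat (int N + s)) / pochhammer (z + of_nat n) N / of_nat N powr (v - z + of_int s))
          \<longlonglongrightarrow> rGamma (v + of_nat n) / rGamma (z + of_nat n)"
    using ratio_tendsto[OF add_of_nat_notin_nonpos_Ints[OF assms(2), of n], of "v - z + of_int s" "v + of_nat n" s 0] by simp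
next
  obtain C1 n\<^sub>0 where C1: "C1 > 0" "\<And>n N. n \<ge> n\<^sub>0 \<Longrightarrow> N > n \<Longrightarrow> norm (pochhammer (v + of_nat n) (nat (int N + s)))
      \<le> C1 * (fact_powr (n + N) (Re v - 1 + of_int s) / fact_powr n (Re v - 1))"
    using norm_pochhammer_add_le[OF assms(1), of s] by auto
  obtain C2 where C2: "C2 > 0" "\<And>n N. fact_powr (n + N) (Re z - 1) / fact_powr n (Re z - 1)
            \<le> C2 * norm (pochhammer (z + of_nat n) N)"
    using norm_pochhammer_add_ge[OF assms(2)] by auto
  define x where "x = Re v - Re z + of_int s"
  have "norm (pochhammer (v + of_nat n) (nat (int N + s)) / pochhammer (z + of_nat n) N) \<le> (C1 * C2 * 2 powr \<bar>x\<bar>) *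
     ((real n + 1) powr (Re z - Re v) * (real (N - n) + 1) powr 0 * (real N + 1) powr x)"
    if "n \<ge> n\<^sub>0" "N > n" for n N
  proof -
    define P where "P = fact_powr (n + N) (Re z - 1) / fact_powr n (Re z - 1)"
    have P: "P > 0" by (simp add: P_def)
    have nz: "norm (pochhammer (z + of_nat n) N) > 0"
      using C2(2)[of n N] P C2(1) unfolding P_def by (smt (verit) mult_eq_0_iff norm_ge_zero)
    have "norm (pochhammer (v + of_nat n) (nat (int N + s)) / pochhammer (z + of_nat n) N)
       \<le> C1 * (fact_powr (n + N) (Re v - 1 + of_int s) / fact_powr n (Re v - 1)) / (P / C2)"
      unfolding norm_divide using C1 C2(1) that P nz C2(2)[of n N]
      by (intro frac_le C1) (auto simp: field_simps P_def less_imp_le)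
    also have "\<dots> = (C1 * C2) * ((fact_powr n (Re z - 1) / fact_powr n (Re v - 1)) *
        (fact_powr (n + N) (Re v - 1 + of_int s) / fact_powr (n + N) (Re z - 1)))"
      by (simp add: P_def)
    also have "\<dots> = (C1 * C2) * ((real n + 1) powr (Re z - Re v) * (real (n + N) + 1) powr x)"
      by (simp add: fact_powr_divide x_def algebra_simps)
    also have "\<dots> \<le> (C1 * C2) * ((real n + 1) powr (Re z - Re v) * (2 powr \<bar>x\<bar> * (real N + 1) powr x))"
      using C1 C2 that by (intro mult_left_mono powr_add_bound) auto
    finally show ?thesis by (simp add: mult_ac)
  qed
  then show "\<exists>C n\<^sub>0. \<forall>n\<ge>n\<^sub>0. \<forall>N>n. norm (pochhammer (v + of_nat n) (nat (int N + s)) / pochhammer (z + of_nat n) N) \<le> C *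
     ((real n + 1) powr (Re z - Re v) * (real (N - n) + 1) powr 0 * (real N + 1) powr (Re v - Re z + of_int s))"
    unfolding x_def by blast
qed

text \<open>The denominator \<open>fact n * fact (N - 1 - n)\<close> is, up to sign, the product of
  the differences between a node and the other nodes of its own family.\<close>

lemma growth_pole:
  "growth (\<lambda>N n. pochhammer (u - of_nat n) (nat (int N + s)) / (fact n * fact (N - 1 - n)))
           (\<lambda>n. rGamma (u - of_nat n) / fact n) (u + of_int s) (- Re u) (Re u + of_int s) 0"
  unfolding growth_def
proof (intro conjI allI)
  fix n
  have one: "(1::complex) \<notin> \<int>\<^sub>\<le>\<^sub>0"
    by simp
  \<comment> \<open>For \<open>N > n\<close>, \<open>fact (N - 1 - n)\<close> is the Pochhammer
    symbol of \<open>1\<close> with length offset \<open>-1 - n\<close>, which makes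
    \<open>ratio_tendsto\<close> applicable.\<close>
  have "(\<lambda>N. pochhammer (u - of_nat n) (nat (int N + s)) / pochhammer 1 (nat (int N + (- 1 - int n))) /
          of_nat N powr (u + of_int s) / fact n) \<longlonglongrightarrow> rGamma (u - of_nat n) / rGamma 1 / fact n"
    by (intro tendsto_divide ratio_tendsto one) auto
  moreover have "nat (int N + (- 1 - int n)) = N - 1 - n" for N by simp
  ultimately show "(\<lambda>N. pochhammer (u - of_nat n) (nat (int N + s)) / (fact n * fact (N - 1 - n)) / of_nat N powr (u + of_int s))
          \<longlonglongrightarrow> rGamma (u - of_nat n) / fact n"
    by (simp add: pochhammer_fact[symmetric] mult_ac)
next
  obtain C1 n\<^sub>0 where C1: "C1 > 0" "\<And>n N. n \<ge> n\<^sub>0 \<Longrightarrow> N > n \<Longrightarrow> norm (pochhammer (u - of_nat n) (nat (int N + s)))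
      \<le> C1 * (fact_powr n (- Re u) * fact_powr (N - n) (Re u - 1 + of_int s))"
    using norm_pochhammer_diff_le[of u s] by auto
  have "norm (pochhammer (u - of_nat n) (nat (int N + s)) / (fact n * fact (N - 1 - n)) :: complex) \<le> C1 *
     ((real n + 1) powr (- Re u) * (real (N - n) + 1) powr (Re u + of_int s) * (real N + 1) powr 0)"
    if n: "n \<ge> n\<^sub>0" "N > n" for n N
  proof -
    define m where "m = N - 1 - n"
    have m: "N - n = Suc m" "N - 1 - n = m"
      using n(2) by (auto simp: m_def)
    have "norm (pochhammer (u - of_nat n) (nat (int N + s)) / (fact n * fact (N - 1 - n)) :: complex)
      \<le> C1 * (fact_powr n (- Re u) * fact_powr (N - n) (Re u - 1 + of_int s)) / (fact n * fact m)"
      unfolding norm_divide norm_mult norm_fact m(2) by (intro divide_right_mono C1 n) auto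
    also have "\<dots> = C1 * ((real n + 1) powr (- Re u) * ((real m + 1) * (real (N - n) + 1) powr (Re u - 1 + of_int s)))"
      unfolding fact_powr_def m(1) by (simp add: field_simps)
    \<comment> \<open>The factor \<open>m + 1\<close> is the quotient of \<open>fact (N - n)\<close>
      by \<open>fact m\<close>; enlarging it to \<open>N - n + 1\<close> lets it merge with the
      power.\<close>
    also have "\<dots> \<le> C1 * ((real n + 1) powr (- Re u) * ((real (N - n) + 1) * (real (N - n) + 1) powr (Re u - 1 + of_int s)))"
      using C1 m by (intro mult_left_mono mult_right_mono) auto
    also have "(real (N - n) + 1) * (real (N - n) + 1) powr (Re u - 1 + of_int s) = (real (N - n) + 1) powr (Re u + of_int s)"
      by (simp add: powr_mult_base)
    finally show ?thesis by simp
  qed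
  then show "\<exists>C n\<^sub>0. \<forall>n\<ge>n\<^sub>0. \<forall>N>n. norm (pochhammer (u - of_nat n) (nat (int N + s)) / (fact n * fact (N - 1 - n)) :: complex) \<le> C *
     ((real n + 1) powr (- Re u) * (real (N - n) + 1) powr (Re u + of_int s) * (real N + 1) powr 0)"
    by blast
qed

subsection \<open>Sums of residues of a rational function\<close>

lemma degree_prod_linear_factors: "degree (\<Prod>w\<in>A. [:- w, 1::'a::idom:]) = card A"
  by (subst degree_prod_eq_sum_degree) auto

text \<open>The polynomial \<open>p\<close> equals its Lagrange interpolant \<open>q\<close>, whose
  basis polynomials are monic of degree \<open>card A - 1\<close>; the coefficients of that degree
  are compared. The left side is the sum of the residues of \<open>p\<close> over the product of the
  linear factors at \<open>A\<close>.\<close>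

lemma lagrange_sum_coeff:
  fixes p :: "complex poly"
  assumes A: "finite A" and p: "degree p < card A"
  shows "(\<Sum>z\<in>A. poly p z / (\<Prod>w\<in>A-{z}. z - w)) = coeff p (card A - 1)"
proof -
  define q where "q = (\<Sum>z\<in>A. smult (poly p z / (\<Prod>w\<in>A-{z}. z - w)) (\<Prod>w\<in>A-{z}. [:- w, 1:]))"
  have deg: "degree (\<Prod>w\<in>A-{z}. [:- w, 1:]) = card A - 1" if "z \<in> A" for z :: complex
    using that A by (simp add: degree_prod_linear_factors)
  have monic: "coeff (\<Prod>w\<in>A-{z}. [:- w, 1:]) (card A - 1) = 1" if "z \<in> A" for z :: complex
    using deg[OF that] lead_coeff_prod[of "\<lambda>w. [:- w, 1:]" "A - {z}"] by simp
  have val: "poly q x = poly p x" if x: "x \<in> A" for x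
  proof -
    have "(\<Prod>w\<in>A-{z}. x - w) = 0" if "z \<in> A - {x}" for z
      using x that A by (intro prod_zero) auto
    then have 0: "(\<Sum>z\<in>A-{x}. poly p z / (\<Prod>w\<in>A-{z}. z - w) * (\<Prod>w\<in>A-{z}. x - w)) = 0"
      by (intro sum.neutral) simp
    have "poly q x = (\<Sum>z\<in>A. poly p z / (\<Prod>w\<in>A-{z}. z - w) * (\<Prod>w\<in>A-{z}. x - w))"
      by (simp add: q_def poly_sum poly_prod)
    also have "\<dots> = poly p x / (\<Prod>w\<in>A-{x}. x - w) * (\<Prod>w\<in>A-{x}. x - w)"
      using A x by (subst sum.remove[of _ x]) (simp_all only: 0 add_0_right)
    also have "\<dots> = poly p x"
      using A by (simp add: prod_zero_iff)
    finally show ?thesis .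
  qed
  have "degree q \<le> card A - 1" unfolding q_def
    using deg by (intro degree_sum_le A order.trans[OF degree_smult_le]) auto
  then have "degree q < card A" using p by simp
  then have "p = q" using p val by (intro poly_eqI_degree[of A]) auto
  then have "coeff p (card A - 1) = coeff q (card A - 1)" by simp
  also have "\<dots> = (\<Sum>z\<in>A. poly p z / (\<Prod>w\<in>A-{z}. z - w))"
    by (simp add: q_def coeff_sum monic del: One_nat_def cong: sum.cong)
  finally show ?thesis ..
qed

text \<open>Differences within the node's own family will become factorials and those to other
  families Pochhammer symbols, so the two products are kept apart.\<close>

lemma lagrange_sum_coeff_families:
  fixes p :: "complex poly" and \<nu> :: "'i \<Rightarrow> 'k \<Rightarrow> complex"
  assumes C: "finite C" and K: "finite K"
    and inj: "inj_on (\<lambda>(c, k). \<nu> c k) (C \<times> K)" and p: "degree p < card C * card K"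
  shows "(\<Sum>c\<in>C. \<Sum>n\<in>K. poly p (\<nu> c n) /
            ((\<Prod>k\<in>K-{n}. \<nu> c n - \<nu> c k) * (\<Prod>d\<in>C-{c}. \<Prod>k\<in>K. \<nu> c n - \<nu> d k)))
         = coeff p (card C * card K - 1)"
proof -
  let ?t = "\<lambda>(c, k). \<nu> c k"
  define A where "A = ?t ` (C \<times> K)"
  have cA: "finite A" "card A = card C * card K"
    using C K inj by (simp_all add: A_def card_image card_cartesian_product)
  have prod: "(\<Prod>w\<in>A-{\<nu> c n}. \<nu> c n - w) =
     (\<Prod>k\<in>K-{n}. \<nu> c n - \<nu> c k) * (\<Prod>d\<in>C-{c}. \<Prod>k\<in>K. \<nu> c n - \<nu> d k)" if cn: "c \<in> C" "n \<in> K" for c n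
  proof -
    have cart: "(\<Prod>x\<in>X \<times> Y. \<nu> c n - ?t x) = (\<Prod>d\<in>X. \<Prod>k\<in>Y. \<nu> c n - \<nu> d k)" for X Y
      by (simp add: prod.cartesian_product case_prod_unfold)
    have "A - {\<nu> c n} = ?t ` (C \<times> K - {(c, n)})"
      using inj cn by (auto simp: A_def inj_on_def)
    then have "(\<Prod>w\<in>A-{\<nu> c n}. \<nu> c n - w) = (\<Prod>x\<in>C \<times> K - {(c, n)}. \<nu> c n - ?t x)"
      using inj by (simp add: prod.reindex inj_on_diff)
    also have "C \<times> K - {(c, n)} = {c} \<times> (K - {n}) \<union> (C - {c}) \<times> K"
      using cn by auto
    also have "(\<Prod>x\<in>{c} \<times> (K - {n}) \<union> (C - {c}) \<times> K. \<nu> c n - ?t x) =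
       (\<Prod>x\<in>{c} \<times> (K - {n}). \<nu> c n - ?t x) * (\<Prod>x\<in>(C - {c}) \<times> K. \<nu> c n - ?t x)"
      using C K by (intro prod.union_disjoint) auto
    also have "\<dots> = (\<Prod>k\<in>K-{n}. \<nu> c n - \<nu> c k) * (\<Prod>d\<in>C-{c}. \<Prod>k\<in>K. \<nu> c n - \<nu> d k)"
      by (simp only: cart) simp
    finally show ?thesis .
  qed
  have "coeff p (card C * card K - 1) = (\<Sum>z\<in>A. poly p z / (\<Prod>w\<in>A-{z}. z - w))"
    using lagrange_sum_coeff[OF cA(1), of p] p cA(2) by simp
  also have "\<dots> = (\<Sum>x\<in>C \<times> K. poly p (?t x) / (\<Prod>w\<in>A-{?t x}. ?t x - w))"
    unfolding A_def using inj by (simp add: sum.reindex)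
  also have "\<dots> = (\<Sum>(c, n)\<in>C \<times> K. poly p (\<nu> c n) / (\<Prod>w\<in>A-{\<nu> c n}. \<nu> c n - w))"
    by (simp add: case_prod_unfold)
  also have "\<dots> = (\<Sum>c\<in>C. \<Sum>n\<in>K. poly p (\<nu> c n) / (\<Prod>w\<in>A-{\<nu> c n}. \<nu> c n - w))"
    by (simp add: sum.cartesian_product)
  also have "\<dots> = (\<Sum>c\<in>C. \<Sum>n\<in>K. poly p (\<nu> c n) /
            ((\<Prod>k\<in>K-{n}. \<nu> c n - \<nu> c k) * (\<Prod>d\<in>C-{c}. \<Prod>k\<in>K. \<nu> c n - \<nu> d k)))"
    by (intro sum.cong refl) (simp add: prod)
  finally show ?thesis ..
qed

lemma prod_diff_add_of_nat:
  fixes x y :: "'a :: comm_ring_1"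
  shows "(\<Prod>k<N. x - (y + of_nat k)) = (-1) ^ N * pochhammer (y - x) N"
  by (induction N) (simp_all add: pochhammer_Suc algebra_simps)

lemma prod_diff_diff_of_nat:
  fixes x y :: "'a :: comm_ring_1"
  shows "(\<Prod>k<N. x - (y - of_nat k)) = pochhammer (x - y) N"
  by (induction N) (simp_all add: pochhammer_Suc algebra_simps)

lemma prod_of_nat_diff_of_nat:
  assumes "n < N"
  shows "(\<Prod>k\<in>{..<N}-{n}. of_nat k - of_nat n :: complex) = (-1) ^ n * (fact n * fact (N - 1 - n))"
proof -
  have split: "{..<N} - {n} = {0..<n} \<union> {Suc n..<N}"
    using assms by auto
  have "(\<Prod>k\<in>{Suc n..<N}. of_nat k - of_nat n :: complex) = (\<Prod>k=0..<N - Suc n. 1 + of_nat k)"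
    by (subst prod.atLeastLessThan_shift_0) (simp add: o_def)
  also have "\<dots> = fact (N - 1 - n)"
    by (simp add: pochhammer_fact pochhammer_prod)
  moreover have "(\<Prod>k=0..<n. of_nat k - of_nat n :: complex) = (-1) ^ n * fact n"
    using pochhammer_same[of n, where 'a = complex] by (simp add: pochhammer_prod)
  ultimately show ?thesis
    unfolding split by (subst prod.union_disjoint) auto
qed

subsection \<open>Limits of the truncated residue sums\<close>

text \<open>\<open>growth_mult\<close> produces unsimplified sums of exponents; this postpones the
  check that they have the required values.\<close>

lemma growth_cong:
  "growth F l d \<alpha> \<beta> \<gamma> \<Longrightarrow> d = d' \<Longrightarrow> \<alpha> = \<alpha>' \<Longrightarrow> \<beta> = \<beta>' \<Longrightarrow> \<gamma> = \<gamma>' \<Longrightarrow> growth F l d' \<alpha>' \<beta>' \<gamma>'"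
  by simp

lemma growth_minus_one_power: "growth (\<lambda>N n. (-1) ^ n) (\<lambda>n. (-1) ^ n) 0 0 0 0"
  unfolding growth_def
proof (intro conjI allI)
  fix n
  have "eventually (\<lambda>N. (-1) ^ n / of_nat N powr 0 = (-1 :: complex) ^ n) sequentially"
    \<comment> \<open>At \<open>N = 0\<close> the value of \<open>0 powr 0\<close> is
      \<open>0\<close>, so this index is left out.\<close>
    using eventually_gt_at_top[of 0] by eventually_elim simp
  then show "(\<lambda>N. (-1) ^ n / of_nat N powr 0) \<longlonglongrightarrow> (-1 :: complex) ^ n"
    by (simp add: tendsto_cong)
qed (auto simp: norm_power intro!: exI[of _ 1])

lemma rGamma_diff_of_nat:
  fixes u :: complex
  shows "rGamma (u - of_nat n) = (-1) ^ n * pochhammer (1 - u) n * rGamma u"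
  using pochhammer_rGamma[of "u - of_nat n" n] pochhammer_diff_of_nat[of n n u] by simp

lemma rGamma_add_of_nat:
  fixes v :: complex
  assumes "v \<notin> \<int>\<^sub>\<le>\<^sub>0"
  shows "rGamma (v + of_nat n) = rGamma v / pochhammer v n"
  using pochhammer_rGamma[of v n] pochhammer_eq_0_imp_nonpos_Int[of v n] assms by (auto simp: field_simps)

text \<open>Only the scaled series is known to be summable. The constants used below contain factors
  such as \<open>rGamma (1 - b)\<close> and may vanish; summability of \<open>f\<close> then does
  not follow, but both sides are \<open>0\<close>.\<close>

lemma suminf_cmult:
  fixes f :: "nat \<Rightarrow> complex"
  assumes "summable (\<lambda>n. c * f n)"
  shows "(\<Sum>n. c * f n) = c * suminf f"
  using assms by (cases "c = 0") (auto simp: suminf_mult summable_cmult_iff)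

text \<open>
  The truncation lengths \<open>N + s\<close> for \<open>1 - b - t\<close> and \<open>N + t\<close> for \<open>g + t\<close>, where \<open>s + t = -1\<close>, are chosen to make
  the exponent of \<open>N - n + 1\<close> nonnegative both at the right poles (\<open>s + 2 - Re (g - a)\<close>) and at the left poles
  (\<open>Re (g - a) - s - 1\<close>); \<open>s = \<lfloor>Re (g - a)\<rfloor> - 1\<close> does both. The right poles \<open>1 - e + n\<close> and \<open>1 - f + n\<close> are
  obtained from the poles \<open>n\<close> by shifting all parameters.
\<close>

definition right_residue :: "int \<Rightarrow> int \<Rightarrow> complex \<Rightarrow> complex \<Rightarrow> complex \<Rightarrow> complex \<Rightarrow>
    complex \<Rightarrow> complex \<Rightarrow> complex \<Rightarrow> nat \<Rightarrow> nat \<Rightarrow> complex" where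
  "right_residue s t a b c d e f g N n =
     (-1) ^ n * (pochhammer (1 - b - of_nat n) (nat (int N + s)) / (fact n * fact (N - 1 - n))) *
     (pochhammer (1 - c - of_nat n) N / pochhammer (1 - e - of_nat n) N) *
     (pochhammer (1 - d - of_nat n) N / pochhammer (1 - f - of_nat n) N) *
     (pochhammer (g + of_nat n) (nat (int N + t)) / pochhammer (a + of_nat n) N)"

text \<open>At the pole \<open>- a - n\<close> the factor \<open>1/Gamma(g + t)\<close> has the
  argument \<open>g - a - n\<close>, so it takes the place that the factor with \<open>b\<close> has
  at the right poles. The length \<open>nat (int N + 0)\<close> is \<open>N\<close>, written so as
  to match \<open>growth_ratio_add\<close>.\<close>

definition left_residue :: "int \<Rightarrow> int \<Rightarrow> complex \<Rightarrow> complex \<Rightarrow> complex \<Rightarrow> complex \<Rightarrow>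
    complex \<Rightarrow> complex \<Rightarrow> complex \<Rightarrow> nat \<Rightarrow> nat \<Rightarrow> complex" where
  "left_residue s t a b c d e f g N n =
     (-1) ^ n * (pochhammer (g - a - of_nat n) (nat (int N + t)) / (fact n * fact (N - 1 - n))) *
     (pochhammer (1 + a - b + of_nat n) (nat (int N + s)) / pochhammer (a + of_nat n) N) *
     (pochhammer (1 + a - c + of_nat n) (nat (int N + 0)) / pochhammer (1 + a - e + of_nat n) N) *
     (pochhammer (1 + a - d + of_nat n) (nat (int N + 0)) / pochhammer (1 + a - f + of_nat n) N)"

lemma one_minus_notin_Ints: "(e::complex) \<notin> \<int> \<Longrightarrow> 1 - e \<notin> \<int>"
  by (metis Ints_1 Ints_diff diff_diff_eq2 add_diff_cancel_left')

text \<open>By \<open>V\<close> and \<open>s + t = -1\<close> the exponents of the five factors add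
  up to \<open>1\<close> for \<open>N\<close>, \<open>-2\<close> for \<open>n + 1\<close> and
  \<open>s + 2 - Re (g - a)\<close> for \<open>N - n + 1\<close>. In the limit the shifted
  \<open>rGamma\<close> values turn into the Pochhammer symbols of the series, and all signs
  cancel.\<close>

lemma right_residue_tendsto:
  assumes V: "e + f + g - a - b - c - d = (1::complex)" and st: "s + t = -1"
    and Re: "Re (g - a) \<le> of_int s + 2"
    and e: "e \<notin> \<int>" and f: "f \<notin> \<int>" and g: "g \<notin> \<int>\<^sub>\<le>\<^sub>0" and a: "a \<notin> \<int>\<^sub>\<le>\<^sub>0"
  shows "(\<lambda>N. (\<Sum>n<N. right_residue s t a b c d e f g N n) / of_nat N) \<longlonglongrightarrow>
     (rGamma (1 - b) * rGamma (1 - c) * rGamma (1 - d) * rGamma g) /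
     (rGamma (1 - e) * rGamma (1 - f) * rGamma a) * F43 a b c d e f g"
proof -
  define l where "l n = (-1) ^ n * (rGamma (1 - b - of_nat n) / fact n) *
     (rGamma (1 - c - of_nat n) / rGamma (1 - e - of_nat n)) *
     (rGamma (1 - d - of_nat n) / rGamma (1 - f - of_nat n)) *
     (rGamma (g + of_nat n) / rGamma (a + of_nat n))" for n
  define K where "K = (rGamma (1 - b) * rGamma (1 - c) * rGamma (1 - d) * rGamma g) /
     (rGamma (1 - e) * rGamma (1 - f) * rGamma a)"
  define \<beta> where "\<beta> = 2 + of_int s - Re (g - a)"
  have V': "Re b = Re e + Re f + Re g - Re a - Re c - Re d - 1"
    using arg_cong[OF V, of Re] by simp
  have V'': "b = e + f + g - a - c - d - 1" using V by (simp add: algebra_simps)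
  have t: "t = -1 - s" using st by simp
  have "growth (right_residue s t a b c d e f g) l 1 (-2) \<beta> (1 - \<beta>)"
    unfolding l_def right_residue_def
    by (rule growth_cong[OF growth_mult[OF growth_mult[OF growth_mult[OF growth_mult[OF
        growth_minus_one_power growth_pole] growth_ratio_diff] growth_ratio_diff] growth_ratio_add]])
      (use e f g a in \<open>simp_all add: one_minus_notin_Ints V' V'' \<beta>_def t\<close>)
  from growth_sum_tendsto[OF this] Re
  have l: "summable l" "(\<lambda>N. (\<Sum>n<N. right_residue s t a b c d e f g N n) / of_nat N) \<longlonglongrightarrow> suminf l"
    by (auto simp: \<beta>_def)
  have eq: "l n = K * ((pochhammer a n * pochhammer b n * pochhammer c n * pochhammer d n) /
          (fact n * pochhammer e n * pochhammer f n * pochhammer g n))" for n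
  proof -
    have sgn: "(-1) ^ n * (-1) ^ n = (1::complex)" by (simp flip: power_mult_distrib)
    have "l n = ((-1) ^ n * (-1) ^ n) * (((-1) ^ n / (-1) ^ n) * (((-1) ^ n / (-1) ^ n) * (K * ((pochhammer a n * pochhammer b n * pochhammer c n * pochhammer d n) /
          (fact n * pochhammer e n * pochhammer f n * pochhammer g n)))))"
      unfolding l_def K_def rGamma_diff_of_nat rGamma_add_of_nat[OF g] rGamma_add_of_nat[OF a]
      by (simp add: mult_ac)
    then show ?thesis by (simp add: sgn)
  qed
  have "suminf l = K * F43 a b c d e f g"
    using l(1) unfolding eq[abs_def] F43_def by (rule suminf_cmult)
  then show ?thesis using l(2) by (simp add: K_def)
qed

text \<open>This series again has excess \<open>1\<close>, so the exponents \<open>1\<close> and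
  \<open>-2\<close> recur. The exponent \<open>\<beta>\<close> here and the one at the right poles
  add up to \<open>1\<close>, so some integer \<open>s\<close> makes both nonnegative.\<close>

lemma left_residue_tendsto:
  assumes V: "e + f + g - a - b - c - d = (1::complex)" and st: "s + t = -1"
    and Re: "of_int s + 1 \<le> Re (g - a)"
    and up: "a \<notin> \<int>\<^sub>\<le>\<^sub>0" "1 + a - e \<notin> \<int>\<^sub>\<le>\<^sub>0" "1 + a - f \<notin> \<int>\<^sub>\<le>\<^sub>0"
    and lo: "1 + a - b \<notin> \<int>\<^sub>\<le>\<^sub>0" "1 + a - c \<notin> \<int>\<^sub>\<le>\<^sub>0" "1 + a - d \<notin> \<int>\<^sub>\<le>\<^sub>0"
  shows "(\<lambda>N. (\<Sum>n<N. left_residue s t a b c d e f g N n) / of_nat N) \<longlonglongrightarrow>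
     (rGamma (g - a) * rGamma (1 + a - b) * rGamma (1 + a - c) * rGamma (1 + a - d)) /
     (rGamma a * rGamma (1 + a - e) * rGamma (1 + a - f)) *
     F43 a (1 + a - e) (1 + a - f) (1 + a - g) (1 + a - b) (1 + a - c) (1 + a - d)"
proof -
  define l where "l n = (-1) ^ n * (rGamma (g - a - of_nat n) / fact n) *
     (rGamma (1 + a - b + of_nat n) / rGamma (a + of_nat n)) *
     (rGamma (1 + a - c + of_nat n) / rGamma (1 + a - e + of_nat n)) *
     (rGamma (1 + a - d + of_nat n) / rGamma (1 + a - f + of_nat n))" for n
  define K where "K = (rGamma (g - a) * rGamma (1 + a - b) * rGamma (1 + a - c) * rGamma (1 + a - d)) /
     (rGamma a * rGamma (1 + a - e) * rGamma (1 + a - f))"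
  define \<beta> where "\<beta> = Re (g - a) - 1 - of_int s"
  have V': "Re b = Re e + Re f + Re g - Re a - Re c - Re d - 1"
    using arg_cong[OF V, of Re] by simp
  have V'': "b = e + f + g - a - c - d - 1" using V by (simp add: algebra_simps)
  have t: "t = -1 - s" using st by simp
  have "growth (left_residue s t a b c d e f g) l 1 (-2) \<beta> (1 - \<beta>)"
    unfolding l_def left_residue_def
    by (rule growth_cong[OF growth_mult[OF growth_mult[OF growth_mult[OF growth_mult[OF
        growth_minus_one_power growth_pole] growth_ratio_add] growth_ratio_add] growth_ratio_add]])
      (use up lo in \<open>simp_all add: V' \<beta>_def t\<close>, use V'' in simp)
  from growth_sum_tendsto[OF this] Re
  have l: "summable l" "(\<lambda>N. (\<Sum>n<N. left_residue s t a b c d e f g N n) / of_nat N) \<longlonglongrightarrow> suminf l"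
    by (auto simp: \<beta>_def)
  have eq: "l n = K * ((pochhammer a n * pochhammer (1 + a - e) n * pochhammer (1 + a - f) n * pochhammer (1 + a - g) n) /
          (fact n * pochhammer (1 + a - b) n * pochhammer (1 + a - c) n * pochhammer (1 + a - d) n))" for n
  proof -
    have sgn: "(-1) ^ n * (-1) ^ n = (1::complex)" by (simp flip: power_mult_distrib)
    have g: "1 - (g - a) = 1 + a - g" by simp
    have "l n = ((-1) ^ n * (-1) ^ n) * (K * ((pochhammer a n * pochhammer (1 + a - e) n * pochhammer (1 + a - f) n * pochhammer (1 + a - g) n) /
          (fact n * pochhammer (1 + a - b) n * pochhammer (1 + a - c) n * pochhammer (1 + a - d) n)))"
      unfolding l_def K_def rGamma_diff_of_nat g up[THEN rGamma_add_of_nat] lo[THEN rGamma_add_of_nat]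
      by (simp add: mult_ac)
    then show ?thesis by (simp add: sgn)
  qed
  have "suminf l = K * F43 a (1 + a - e) (1 + a - f) (1 + a - g) (1 + a - b) (1 + a - c) (1 + a - d)"
    using l(1) unfolding eq[abs_def] F43_def by (rule suminf_cmult)
  then show ?thesis using l(2) by (simp add: K_def)
qed

section \<open>The truncated residues as terms of the Lagrange sum\<close>

definition pochhammer_poly :: "complex \<Rightarrow> complex \<Rightarrow> nat \<Rightarrow> complex poly" where
  "pochhammer_poly x y m = (\<Prod>k<m. [:x + of_nat k, y:])"

lemma poly_pochhammer_poly: "poly (pochhammer_poly x y m) t = pochhammer (x + y * t) m"
  by (induction m) (simp_all add: pochhammer_poly_def pochhammer_Suc algebra_simps)

lemma degree_pochhammer_poly: "y \<noteq> 0 \<Longrightarrow> degree (pochhammer_poly x y m) = m"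
  unfolding pochhammer_poly_def by (subst degree_prod_eq_sum_degree) auto

lemma lead_coeff_pochhammer_poly: "y \<noteq> 0 \<Longrightarrow> lead_coeff (pochhammer_poly x y m) = y ^ m"
  unfolding pochhammer_poly_def by (subst lead_coeff_prod) auto

lemma pochhammer_poly_nonzero: "y \<noteq> 0 \<Longrightarrow> pochhammer_poly x y m \<noteq> 0"
  unfolding pochhammer_poly_def by (subst prod_zero_iff) auto

text \<open>One computation serves all three right families: \<open>x\<close> is the base point
  \<open>0\<close>, \<open>1 - e\<close> or \<open>1 - f\<close>, and \<open>y1\<close>,
  \<open>y2\<close> are the other two. Moving the origin to \<open>x\<close> adds \<open>x\<close>
  to \<open>a\<close>, \<open>b\<close>, \<open>c\<close>, \<open>d\<close>, \<open>g\<close>, and a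
  base point \<open>y\<close> becomes the lower parameter \<open>1 + x - y\<close>.\<close>

lemma right_node:
  assumes "n < N"
  shows "pochhammer (1 - b - (x + of_nat n)) (nat (int N + s)) * pochhammer (1 - c - (x + of_nat n)) N *
      pochhammer (1 - d - (x + of_nat n)) N * pochhammer (g + (x + of_nat n)) (nat (int N + t)) /
      ((\<Prod>k\<in>{..<N}-{n}. (x + of_nat n) - (x + of_nat k)) *
       ((\<Prod>k<N. (x + of_nat n) - (y1 + of_nat k)) * ((\<Prod>k<N. (x + of_nat n) - (y2 + of_nat k)) *
        (\<Prod>k<N. (x + of_nat n) - (- a - of_nat k))))) =
    (-1) ^ (N - 1) * right_residue s t (a + x) (b + x) (c + x) (d + x) (1 + x - y1) (1 + x - y2) (g + x) N n"
proof -
  have "(\<Prod>k\<in>{..<N}-{n}. (x + of_nat n) - (x + of_nat k)) = (\<Prod>k\<in>{..<N}-{n}. (-1) * (of_nat k - of_nat n))"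
    by (intro prod.cong) auto
  also have "\<dots> = (-1) ^ (N - 1) * ((-1) ^ n * (fact n * fact (N - 1 - n)))"
    unfolding prod.distrib using assms by (simp add: prod_of_nat_diff_of_nat)
  finally have 1: "(\<Prod>k\<in>{..<N}-{n}. (x + of_nat n) - (x + of_nat k)) =
      (-1) ^ (N - 1) * ((-1) ^ n * (fact n * fact (N - 1 - n)))" .
  have sgn: "(-1) ^ m * (-1) ^ m = (1::complex)" for m by (simp flip: power_mult_distrib)
  have inv: "1 / (-1) ^ m = ((-1) ^ m :: complex)" for m
    by (simp add: power_one_over[symmetric])
  have args: "y1 - (x + of_nat n) = 1 - (1 + x - y1) - of_nat n" "y2 - (x + of_nat n) = 1 - (1 + x - y2) - of_nat n"
    "(x + of_nat n) - (- a) = a + x + of_nat n" "1 - b - (x + of_nat n) = 1 - (b + x) - of_nat n"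
    "1 - c - (x + of_nat n) = 1 - (c + x) - of_nat n" "1 - d - (x + of_nat n) = 1 - (d + x) - of_nat n"
    "g + (x + of_nat n) = g + x + of_nat n"
    by simp_all
  \<comment> \<open>Here \<open>\<rho>\<close> stands for \<open>(-1) ^ N\<close>; it comes once
    from each of the two other right families and so cancels.\<close>
  have "P1 * P2 * P3 * P4 / (\<sigma> * (\<tau> * (F * F')) * (\<rho> * Q1 * (\<rho> * Q2 * Q3))) =
     (1 / \<sigma>) * ((1 / \<tau>) * (P1 / (F * F')) * (P2 / Q1) * (P3 / Q2) * (P4 / Q3))"
    if "\<rho> * \<rho> = 1" for P1 P2 P3 P4 \<sigma> \<tau> F F' \<rho> Q1 Q2 Q3 :: complex
  proof -
    have "\<sigma> * (\<tau> * (F * F')) * (\<rho> * Q1 * (\<rho> * Q2 * Q3)) = (\<rho> * \<rho>) * (\<sigma> * (\<tau> * (F * F')) * (Q1 * (Q2 * Q3)))"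
      by (simp only: mult_ac)
    then show ?thesis using that by (simp add: mult_ac)
  qed
  note eq = this[OF sgn[of N]]
  show ?thesis
    unfolding 1 prod_diff_add_of_nat prod_diff_diff_of_nat args right_residue_def eq inv by (rule refl)
qed

text \<open>Seen from a left node there are three right families, so one sign
  \<open>(-1) ^ N\<close> survives. Against the \<open>(-1) ^ (N - 1)\<close> of
  \<open>right_node\<close> this explains the minus sign of the left sum.\<close>

lemma left_node:
  assumes "n < N"
  shows "pochhammer (1 - b - (- a - of_nat n)) (nat (int N + s)) * pochhammer (1 - c - (- a - of_nat n)) N *
      pochhammer (1 - d - (- a - of_nat n)) N * pochhammer (g + (- a - of_nat n)) (nat (int N + t)) /
      ((\<Prod>k\<in>{..<N}-{n}. (- a - of_nat n) - (- a - of_nat k)) *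
       ((\<Prod>k<N. (- a - of_nat n) - (0 + of_nat k)) * ((\<Prod>k<N. (- a - of_nat n) - (1 - e + of_nat k)) *
        (\<Prod>k<N. (- a - of_nat n) - (1 - f + of_nat k))))) =
    (-1) ^ N * left_residue s t a b c d e f g N n"
proof -
  have 1: "(\<Prod>k\<in>{..<N}-{n}. (- a - of_nat n) - (- a - of_nat k)) = (-1) ^ n * (fact n * fact (N - 1 - n))"
    using assms by (simp add: prod_of_nat_diff_of_nat)
  have sgn: "(-1) ^ m * (-1) ^ m = (1::complex)" for m by (simp flip: power_mult_distrib)
  have inv: "1 / (-1) ^ m = ((-1) ^ m :: complex)" for m
    by (simp add: power_one_over[symmetric])
  have args: "0 - (- a - of_nat n) = a + of_nat n" "1 - e - (- a - of_nat n) = 1 + a - e + of_nat n"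
    "1 - f - (- a - of_nat n) = 1 + a - f + of_nat n" "1 - b - (- a - of_nat n) = 1 + a - b + of_nat n"
    "1 - c - (- a - of_nat n) = 1 + a - c + of_nat n" "1 - d - (- a - of_nat n) = 1 + a - d + of_nat n"
    "g + (- a - of_nat n) = g - a - of_nat n"
    by simp_all
  have "P1 * P2 * P3 * P4 / (\<tau> * (F * F') * (\<rho> * Q1 * (\<rho> * Q2 * (\<rho> * Q3)))) =
     (1 / \<rho>) * ((1 / \<tau>) * (P4 / (F * F')) * (P1 / Q1) * (P2 / Q2) * (P3 / Q3))"
    if "\<rho> * \<rho> = 1" for P1 P2 P3 P4 \<tau> F F' \<rho> Q1 Q2 Q3 :: complex
  proof -
    have "\<tau> * (F * F') * (\<rho> * Q1 * (\<rho> * Q2 * (\<rho> * Q3))) = (\<rho> * \<rho>) * (\<rho> * (\<tau> * (F * F')) * (Q1 * (Q2 * Q3)))"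
      by (simp only: mult_ac)
    then show ?thesis using that by (simp add: mult_ac)
  qed
  note eq = this[OF sgn[of N]]
  show ?thesis
    unfolding 1 prod_diff_add_of_nat args left_residue_def eq inv by simp
qed

text \<open>The nonintegrality assumptions keep the four families of nodes disjoint. The Lagrange
  sum is then the leading coefficient of \<open>p\<close>, a power of \<open>-1\<close>; taking
  norms discards its sign.\<close>

lemma norm_sum_residues:
  assumes st: "s + t = -1" and N: "int N + s \<ge> 0" "int N + t \<ge> 0" "N > 0"
    and nonint: "a \<notin> \<int>" "e \<notin> \<int>" "f \<notin> \<int>" "f - e \<notin> \<int>" "e - a \<notin> \<int>" "f - a \<notin> \<int>"
  shows "norm ((\<Sum>n<N. right_residue s t a b c d e f g N n)
     + (\<Sum>n<N. right_residue s t (1 + a - e) (1 + b - e) (1 + c - e) (1 + d - e) (2 - e) (1 + f - e) (1 + g - e) N n)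
     + (\<Sum>n<N. right_residue s t (1 + a - f) (1 + b - f) (1 + c - f) (1 + d - f) (2 - f) (1 + e - f) (1 + g - f) N n)
     - (\<Sum>n<N. left_residue s t a b c d e f g N n)) = 1"
proof -
  define S T where "S = nat (int N + s)" and "T = nat (int N + t)"
  \<comment> \<open>This puts the degree \<open>S + 2 * N + T\<close> of \<open>p\<close> exactly
    one below the number \<open>4 * N\<close> of nodes.\<close>
  have ST: "S + T + 1 = 2 * N" using st N by (simp add: S_def T_def)
  define p where "p = pochhammer_poly (1 - b) (-1) S * pochhammer_poly (1 - c) (-1) N *
     pochhammer_poly (1 - d) (-1) N * pochhammer_poly g 1 T"
  have pt: "poly p z = pochhammer (1 - b - z) S * pochhammer (1 - c - z) N *
      pochhammer (1 - d - z) N * pochhammer (g + z) T" for z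
    by (simp add: p_def poly_pochhammer_poly)
  have deg: "degree p = S + N + N + T"
    by (simp add: p_def degree_mult_eq degree_pochhammer_poly pochhammer_poly_nonzero)
  have "lead_coeff p = (-1) ^ S * (-1) ^ N * (-1) ^ N"
    by (simp only: p_def lead_coeff_mult lead_coeff_pochhammer_poly) (simp add: lead_coeff_pochhammer_poly)
  then have lc: "norm (coeff p (S + N + N + T)) = 1"
    by (simp add: deg norm_mult norm_power)
  define \<nu> :: "nat \<Rightarrow> nat \<Rightarrow> complex" where
    "\<nu> c k = (if c = 0 then 0 + of_nat k else if c = 1 then 1 - e + of_nat k
               else if c = 2 then 1 - f + of_nat k else - a - of_nat k)" for c k
  have \<nu>: "\<nu> 0 = (\<lambda>k. 0 + of_nat k)" "\<nu> 1 = (\<lambda>k. 1 - e + of_nat k)" "\<nu> 2 = (\<lambda>k. 1 - f + of_nat k)" "\<nu> 3 = (\<lambda>k. - a - of_nat k)"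
    by (simp_all add: \<nu>_def fun_eq_iff)
  have ints: "x - y \<in> \<int>" if "x + of_int k = y + of_int l" for x y :: complex and k l
  proof -
    have "x - y = of_int (l - k)" using that by (simp add: algebra_simps)
    then show ?thesis by (simp only: Ints_of_int)
  qed
  have sep: "\<nu> c k \<noteq> \<nu> d l" if cd: "c < d" "c \<in> {0,1,2,3}" "d \<in> {0,1,2,3}" for c d k l
  proof
    assume eq: "\<nu> c k = \<nu> d l"
    consider "c = 0" "d = 1" | "c = 0" "d = 2" | "c = 0" "d = 3" | "c = 1" "d = 2" | "c = 1" "d = 3" | "c = 2" "d = 3"
      using cd by auto
    then show False
    proof cases
      case 1
      then have "e + of_int k = 0 + of_int (1 + l)" using eq by (simp add: \<nu>_def algebra_simps)
      then show False using ints nonint by fastforce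
    next
      case 2
      then have "f + of_int k = 0 + of_int (1 + l)" using eq by (simp add: \<nu>_def algebra_simps)
      then show False using ints nonint by fastforce
    next
      case 3
      then have "of_nat k = - a - of_nat l" using eq by (simp add: \<nu>_def)
      then have "a + of_int k = 0 + of_int (- int l)" by simp
      then show False using ints nonint by fastforce
    next
      case 4
      then have "f + of_int k = e + of_int l" using eq by (simp add: \<nu>_def algebra_simps)
      then show False using ints nonint by fastforce
    next
      case 5
      then have "e + of_int (- 1 - int k) = a + of_int l" using eq by (simp add: \<nu>_def algebra_simps)
      then show False using ints nonint by fastforce
    next
      case 6
      then have "f + of_int (- 1 - int k) = a + of_int l" using eq by (simp add: \<nu>_def algebra_simps)
      then show False using ints nonint by fastforce
    qed
  qed
  have inj1: "k = l" if "\<nu> c k = \<nu> c l" for c k l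
    using that by (simp add: \<nu>_def split: if_splits)
  have inj: "inj_on (\<lambda>(c, k). \<nu> c k) ({0,1,2,3} \<times> {..<N})"
  proof (rule inj_onI, clarify)
    fix c k d l assume "c \<in> {0,1,2,3::nat}" "d \<in> {0,1,2,3::nat}" and eq: "\<nu> c k = \<nu> d l"
    then have "c = d" using sep by (metis linorder_neqE_nat)
    then show "c = d \<and> k = l" using inj1 eq by simp
  qed
  have sums: "sum h {0,1,2,3::nat} = h 0 + (h 1 + (h 2 + h 3))" for h :: "nat \<Rightarrow> complex"
    by simp
  have prods: "prod h ({0,1,2,3} - {0::nat}) = h 1 * (h 2 * h 3)" "prod h ({0,1,2,3} - {1::nat}) = h 0 * (h 2 * h 3)"
     "prod h ({0,1,2,3} - {2::nat}) = h 0 * (h 1 * h 3)" "prod h ({0,1,2,3} - {3::nat}) = h 0 * (h 1 * h 2)"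
     for h :: "nat \<Rightarrow> complex"
    by (simp_all add: insert_Diff_if)
  have cd: "card {0,1,2,3::nat} * card {..<N} = 4 * N" "4 * N - 1 = S + N + N + T"
    using ST by auto
  have arg: "a + 0 = a" "b + 0 = b" "c + 0 = c" "d + 0 = d" "g + 0 = g" "1 + 0 - (1 - e) = e" "1 + 0 - (1 - f) = f"
     "a + (1 - e) = 1 + a - e" "b + (1 - e) = 1 + b - e" "c + (1 - e) = 1 + c - e" "d + (1 - e) = 1 + d - e" "g + (1 - e) = 1 + g - e"
     "a + (1 - f) = 1 + a - f" "b + (1 - f) = 1 + b - f" "c + (1 - f) = 1 + c - f" "d + (1 - f) = 1 + d - f" "g + (1 - f) = 1 + g - f"
     "1 + (1 - e) - 0 = 2 - e" "1 + (1 - e) - (1 - f) = 1 + f - e"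
     "1 + (1 - f) - 0 = 2 - f" "1 + (1 - f) - (1 - e) = 1 + e - f"
    by simp_all
  have "coeff p (S + N + N + T) = (\<Sum>c\<in>{0,1,2,3}. \<Sum>n<N. poly p (\<nu> c n) /
            ((\<Prod>k\<in>{..<N}-{n}. \<nu> c n - \<nu> c k) * (\<Prod>d\<in>{0,1,2,3}-{c}. \<Prod>k<N. \<nu> c n - \<nu> d k)))"
    using lagrange_sum_coeff_families[OF _ _ inj, of p] N ST unfolding cd by (simp only: deg finite.intros finite_lessThan)
  also have "\<dots> = (\<Sum>n<N. (-1) ^ (N - 1) * right_residue s t a b c d e f g N n)
     + ((\<Sum>n<N. (-1) ^ (N - 1) * right_residue s t (1 + a - e) (1 + b - e) (1 + c - e) (1 + d - e) (2 - e) (1 + f - e) (1 + g - e) N n)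
     + ((\<Sum>n<N. (-1) ^ (N - 1) * right_residue s t (1 + a - f) (1 + b - f) (1 + c - f) (1 + d - f) (2 - f) (1 + e - f) (1 + g - f) N n)
     + (\<Sum>n<N. (-1) ^ N * left_residue s t a b c d e f g N n)))"
    unfolding sums prods \<nu> pt S_def T_def
  proof (intro arg_cong2[where f = "(+)"] sum.cong refl, goal_cases)
    case (1 n) then show ?case
      using right_node[of n N b 0 s c d g t "1 - e" "1 - f" a] unfolding arg by simp
  next
    case (2 n) then show ?case
      using right_node[of n N b "1 - e" s c d g t 0 "1 - f" a] unfolding arg by simp
  next
    case (3 n) then show ?case
      using right_node[of n N b "1 - f" s c d g t 0 "1 - e" a] unfolding arg by simp
  next
    case (4 n) then show ?case
      using left_node[of n N b a s c d g t e f] by simp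
  qed
  also have "\<dots> = (-1) ^ (N - 1) * ((\<Sum>n<N. right_residue s t a b c d e f g N n)
     + (\<Sum>n<N. right_residue s t (1 + a - e) (1 + b - e) (1 + c - e) (1 + d - e) (2 - e) (1 + f - e) (1 + g - e) N n)
     + (\<Sum>n<N. right_residue s t (1 + a - f) (1 + b - f) (1 + c - f) (1 + d - f) (2 - f) (1 + e - f) (1 + g - f) N n)
     - (\<Sum>n<N. left_residue s t a b c d e f g N n))"
  proof -
    have "(-1) ^ N = - ((-1) ^ (N - 1) :: complex)" using N by (cases N) auto
    then have "(\<Sum>n<N. (-1) ^ N * left_residue s t a b c d e f g N n) =
        - ((-1) ^ (N - 1) * (\<Sum>n<N. left_residue s t a b c d e f g N n))"
      by (simp only: mult_minus_left sum_negf sum_distrib_left)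
    then show ?thesis by (simp only: sum_distrib_left[symmetric]) (simp add: algebra_simps)
  qed
  finally show ?thesis using lc by (simp add: norm_mult norm_power)
qed

subsection \<open>The four-term relation\<close>

lemma sin_pi_Ints: "x \<in> \<int> \<Longrightarrow> sin (of_real pi * x :: complex) = 0"
proof (elim Ints_cases)
  fix n assume "x = of_int n"
  then have "of_real pi * x = of_real (pi * of_int n)" by simp
  then show ?thesis by (simp only: sin_of_real sin_npi_int of_real_0)
qed

lemma four_term_relation:
  assumes V: "e + f + g - a - b - c - d = (1::complex)"
    and nonint: "a \<notin> \<int>" "e \<notin> \<int>" "f \<notin> \<int>" "f - e \<notin> \<int>" "e - a \<notin> \<int>" "f - a \<notin> \<int>"
    and lower: "g \<notin> \<int>\<^sub>\<le>\<^sub>0" "1 + g - e \<notin> \<int>\<^sub>\<le>\<^sub>0" "1 + g - f \<notin> \<int>\<^sub>\<le>\<^sub>0"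
      "1 + a - b \<notin> \<int>\<^sub>\<le>\<^sub>0" "1 + a - c \<notin> \<int>\<^sub>\<le>\<^sub>0" "1 + a - d \<notin> \<int>\<^sub>\<le>\<^sub>0"
  shows "(rGamma (1 - b) * rGamma (1 - c) * rGamma (1 - d) * rGamma g) /
           (rGamma (1 - e) * rGamma (1 - f) * rGamma a) * F43 a b c d e f g
       + (rGamma (e - b) * rGamma (e - c) * rGamma (e - d) * rGamma (1 + g - e)) /
           (rGamma (e - 1) * rGamma (e - f) * rGamma (1 + a - e)) *
           F43 (1 + a - e) (1 + b - e) (1 + c - e) (1 + d - e) (2 - e) (1 + f - e) (1 + g - e)
       + (rGamma (f - b) * rGamma (f - c) * rGamma (f - d) * rGamma (1 + g - f)) /
           (rGamma (f - 1) * rGamma (f - e) * rGamma (1 + a - f)) *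
           F43 (1 + a - f) (1 + b - f) (1 + c - f) (1 + d - f) (2 - f) (1 + e - f) (1 + g - f)
       - (rGamma (g - a) * rGamma (1 + a - b) * rGamma (1 + a - c) * rGamma (1 + a - d)) /
           (rGamma a * rGamma (1 + a - e) * rGamma (1 + a - f)) *
           F43 a (1 + a - e) (1 + a - f) (1 + a - g) (1 + a - b) (1 + a - c) (1 + a - d) = 0"
    (is "?X0 + ?Xe + ?Xf - ?Xa = 0")
proof -
  \<comment> \<open>The shifts by \<open>1 - e\<close> and \<open>1 - f\<close> leave
    \<open>g - a\<close> unchanged, so one \<open>s\<close> serves all three right families.\<close>
  define s where "s = \<lfloor>Re (g - a)\<rfloor> - 1"
  define t where "t = -1 - s"
  have st: "s + t = -1" by (simp add: t_def)
  have s: "Re (g - a) \<le> of_int s + 2" "of_int s + 1 \<le> Re (g - a)"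
    using floor_correct[of "Re (g - a)"] unfolding s_def of_int_diff of_int_1 by linarith+
  have shift: "x - y \<notin> \<int> \<Longrightarrow> of_int k + x - y \<notin> \<int>" "x - y \<notin> \<int> \<Longrightarrow> of_int k + y - x \<notin> \<int>"
    "x \<notin> \<int> \<Longrightarrow> of_int k - x \<notin> \<int>" for x y :: complex and k
  proof -
    show "x - y \<notin> \<int> \<Longrightarrow> of_int k + x - y \<notin> \<int>"
      by (metis Ints_diff Ints_of_int add_diff_cancel_left' add_diff_eq)
    show "x - y \<notin> \<int> \<Longrightarrow> of_int k + y - x \<notin> \<int>"
      by (metis Ints_diff Ints_of_int add_diff_cancel_left' diff_diff_eq2)
    show "x \<notin> \<int> \<Longrightarrow> of_int k - x \<notin> \<int>"
      by (metis Ints_diff Ints_of_int add_diff_cancel_left' diff_diff_eq2)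
  qed
  have ni: "2 - e \<notin> \<int>" "2 - f \<notin> \<int>" "1 + f - e \<notin> \<int>" "1 + e - f \<notin> \<int>" "1 + a - e \<notin> \<int>" "1 + a - f \<notin> \<int>"
    using shift(3)[OF nonint(2), of 2] shift(3)[OF nonint(3), of 2] shift(1)[OF nonint(4), of 1]
      shift(2)[OF nonint(4), of 1] shift(2)[OF nonint(5), of 1] shift(2)[OF nonint(6), of 1] by simp_all
  have np: "x \<notin> \<int> \<Longrightarrow> x \<notin> \<int>\<^sub>\<le>\<^sub>0" for x :: complex
    using nonpos_Ints_Int by blast
  let ?R0 = "\<lambda>N. \<Sum>n<N. right_residue s t a b c d e f g N n"
  let ?Re = "\<lambda>N. \<Sum>n<N. right_residue s t (1 + a - e) (1 + b - e) (1 + c - e) (1 + d - e) (2 - e) (1 + f - e) (1 + g - e) N n"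
  let ?Rf = "\<lambda>N. \<Sum>n<N. right_residue s t (1 + a - f) (1 + b - f) (1 + c - f) (1 + d - f) (2 - f) (1 + e - f) (1 + g - f) N n"
  let ?L = "\<lambda>N. \<Sum>n<N. left_residue s t a b c d e f g N n"
  have 0: "(\<lambda>N. ?R0 N / of_nat N) \<longlonglongrightarrow> ?X0"
    using V st s nonint lower np by (intro right_residue_tendsto) auto
  have "(\<lambda>N. ?Re N / of_nat N) \<longlonglongrightarrow>
     (rGamma (1 - (1 + b - e)) * rGamma (1 - (1 + c - e)) * rGamma (1 - (1 + d - e)) * rGamma (1 + g - e)) /
     (rGamma (1 - (2 - e)) * rGamma (1 - (1 + f - e)) * rGamma (1 + a - e)) *
     F43 (1 + a - e) (1 + b - e) (1 + c - e) (1 + d - e) (2 - e) (1 + f - e) (1 + g - e)"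
    using V st s ni lower np by (intro right_residue_tendsto) (auto simp: algebra_simps)
  then have e: "(\<lambda>N. ?Re N / of_nat N) \<longlonglongrightarrow> ?Xe" by simp
  have "(\<lambda>N. ?Rf N / of_nat N) \<longlonglongrightarrow>
     (rGamma (1 - (1 + b - f)) * rGamma (1 - (1 + c - f)) * rGamma (1 - (1 + d - f)) * rGamma (1 + g - f)) /
     (rGamma (1 - (2 - f)) * rGamma (1 - (1 + e - f)) * rGamma (1 + a - f)) *
     F43 (1 + a - f) (1 + b - f) (1 + c - f) (1 + d - f) (2 - f) (1 + e - f) (1 + g - f)"
    using V st s ni lower np by (intro right_residue_tendsto) (auto simp: algebra_simps)
  then have f: "(\<lambda>N. ?Rf N / of_nat N) \<longlonglongrightarrow> ?Xf" by simp
  have L: "(\<lambda>N. ?L N / of_nat N) \<longlonglongrightarrow> ?Xa"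
    using V st s ni nonint lower np by (intro left_residue_tendsto) auto
  have lim: "(\<lambda>N. (?R0 N + ?Re N + ?Rf N - ?L N) / of_nat N) \<longlonglongrightarrow> ?X0 + ?Xe + ?Xf - ?Xa"
    unfolding add_divide_distrib diff_divide_distrib by (intro tendsto_add tendsto_diff 0 e f L)
  have "eventually (\<lambda>N. norm ((?R0 N + ?Re N + ?Rf N - ?L N) / of_nat N) = 1 / real N) sequentially"
    using eventually_gt_at_top[of 0] eventually_ge_at_top[of "nat (-s)"] eventually_ge_at_top[of "nat (-t)"]
  proof eventually_elim
    case (elim N)
    then have N: "int N + s \<ge> 0" "int N + t \<ge> 0" by auto
    show ?case unfolding norm_divide norm_sum_residues[OF st N elim(1) nonint] by simp
  qed
  then have "(\<lambda>N. norm ((?R0 N + ?Re N + ?Rf N - ?L N) / of_nat N)) \<longlonglongrightarrow> 0"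
    by (subst tendsto_cong) (auto intro: lim_1_over_n)
  then have "(\<lambda>N. (?R0 N + ?Re N + ?Rf N - ?L N) / of_nat N) \<longlonglongrightarrow> 0"
    by (rule tendsto_norm_zero_cancel)
  then show ?thesis using lim LIMSEQ_unique by blast
qed

text \<open>Divided by \<open>sin E * sin F * sin (F - E)\<close>, this is a residue theorem on a
  period strip: the function \<open>sin (x - B) * sin (x - C) * sin (x - D) / (sin x * sin (x - E) *
  sin (x - F))\<close> has poles at \<open>0\<close>, \<open>E\<close>, \<open>F\<close>, and its
  limits at the two ends of the strip contribute \<open>sin (E + F - B - C - D)\<close>. The direct
  proof by addition formulas needs no case distinction for vanishing sines.\<close>

lemma sin_product_identity:
  fixes B C D E F :: complex
  shows "sin (F - E) * sin (E + F - B - C - D) * sin E * sin F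
     + sin F * sin (E - B) * sin (E - C) * sin (E - D)
     - sin E * sin (F - B) * sin (F - C) * sin (F - D) = - (sin (F - E) * sin B * sin C * sin D)"
proof -
  define p q r u where "p = sin E" "q = cos E" "r = sin F" "u = cos F"
  note d = this
  have pyth: "q * q = 1 - p * p" "u * u = 1 - r * r"
    using sin_cos_squared_add[of E] sin_cos_squared_add[of F] by (simp_all add: d power2_eq_square algebra_simps)
  show ?thesis
    unfolding sin_diff cos_diff sin_add cos_add d[symmetric]
    using pyth by algebra
qed

section \<open>Terminating series and their reversal\<close>

text \<open>Absorbing the Pochhammer symbols into \<open>rGamma\<close> factors yields a sum whose
  shape is preserved by \<open>n\<close> to \<open>M - n\<close>, with no quotients and no
  restriction on \<open>u1\<close>, \<open>u2\<close>, \<open>u3\<close>.\<close>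

lemma terminating_F43:
  assumes "v1 \<notin> \<int>\<^sub>\<le>\<^sub>0" "v2 \<notin> \<int>\<^sub>\<le>\<^sub>0" "v3 \<notin> \<int>\<^sub>\<le>\<^sub>0"
  shows "rGamma u1 * rGamma u2 * rGamma u3 * rGamma v1 * rGamma v2 * rGamma v3 *
      F43 (- of_nat M) (1 - u1) (1 - u2) (1 - u3) v1 v2 v3 =
    (\<Sum>n\<le>M. of_nat (M choose n) * rGamma (u1 - of_nat n) * rGamma (u2 - of_nat n) * rGamma (u3 - of_nat n) *
      rGamma (v1 + of_nat n) * rGamma (v2 + of_nat n) * rGamma (v3 + of_nat n))"
proof -
  have "F43 (- of_nat M) (1 - u1) (1 - u2) (1 - u3) v1 v2 v3 =
    (\<Sum>n\<le>M. (pochhammer (- of_nat M) n * pochhammer (1 - u1) n * pochhammer (1 - u2) n * pochhammer (1 - u3) n) /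
          (fact n * pochhammer v1 n * pochhammer v2 n * pochhammer v3 n))"
    unfolding F43_def by (rule suminf_finite) (auto simp: pochhammer_of_nat_eq_0_iff)
  then show ?thesis
  proof (simp only: sum_distrib_left, intro sum.cong refl)
    fix n assume "n \<in> {..M}"
    have ch: "pochhammer (- of_nat M) n / fact n = (-1) ^ n * (of_nat (M choose n) :: complex)"
      unfolding binomial_gbinomial gbinomial_pochhammer by (simp add: power_mult_distrib[symmetric])
    have sgn: "(-1) ^ n * (-1) ^ n = (1::complex)" by (simp flip: power_mult_distrib)
    have "rGamma u1 * rGamma u2 * rGamma u3 * rGamma v1 * rGamma v2 * rGamma v3 *
       ((pochhammer (- of_nat M) n * pochhammer (1 - u1) n * pochhammer (1 - u2) n * pochhammer (1 - u3) n) /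
          (fact n * pochhammer v1 n * pochhammer v2 n * pochhammer v3 n)) =
      (pochhammer (- of_nat M) n / fact n) * (rGamma u1 * rGamma u2 * rGamma u3 * rGamma v1 * rGamma v2 * rGamma v3 *
       ((pochhammer (1 - u1) n * pochhammer (1 - u2) n * pochhammer (1 - u3) n) /
          (pochhammer v1 n * pochhammer v2 n * pochhammer v3 n)))"
      by (simp add: mult_ac)
    \<comment> \<open>Each of the three upper symbols needs a sign \<open>(-1) ^ n\<close>: one
      comes from the binomial coefficient, the other two from an inserted factor
      \<open>1\<close>.\<close>
    also have "\<dots> = of_nat (M choose n) * ((-1) ^ n * pochhammer (1 - u1) n * rGamma u1) *
       (((-1) ^ n * (-1) ^ n) * (pochhammer (1 - u2) n * rGamma u2)) * (pochhammer (1 - u3) n * rGamma u3) *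
       (rGamma v1 / pochhammer v1 n) * (rGamma v2 / pochhammer v2 n) * (rGamma v3 / pochhammer v3 n)"
      unfolding ch sgn by simp
    also have "\<dots> = of_nat (M choose n) * rGamma (u1 - of_nat n) * rGamma (u2 - of_nat n) * rGamma (u3 - of_nat n) *
      rGamma (v1 + of_nat n) * rGamma (v2 + of_nat n) * rGamma (v3 + of_nat n)"
      unfolding rGamma_diff_of_nat assms[THEN rGamma_add_of_nat] by (simp add: mult_ac)
    finally show "rGamma u1 * rGamma u2 * rGamma u3 * rGamma v1 * rGamma v2 * rGamma v3 *
       ((pochhammer (- of_nat M) n * pochhammer (1 - u1) n * pochhammer (1 - u2) n * pochhammer (1 - u3) n) /
          (fact n * pochhammer v1 n * pochhammer v2 n * pochhammer v3 n)) =
      of_nat (M choose n) * rGamma (u1 - of_nat n) * rGamma (u2 - of_nat n) * rGamma (u3 - of_nat n) *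
      rGamma (v1 + of_nat n) * rGamma (v2 + of_nat n) * rGamma (v3 + of_nat n)" .
  qed
qed

text \<open>Under \<open>n\<close> to \<open>M - n\<close> the increasing and decreasing arguments
  trade places: for instance \<open>1 - a - n\<close> becomes \<open>2 - e + n\<close>, and
  \<open>1 + a - b + n\<close> becomes \<open>e - b - n\<close>.\<close>

lemma terminating_F43_reverse:
  assumes "1 + a - b \<notin> \<int>\<^sub>\<le>\<^sub>0" "1 + a - c \<notin> \<int>\<^sub>\<le>\<^sub>0" "1 + a - d \<notin> \<int>\<^sub>\<le>\<^sub>0"
    and "2 - e \<notin> \<int>\<^sub>\<le>\<^sub>0" "1 + f - e \<notin> \<int>\<^sub>\<le>\<^sub>0" "1 + g - e \<notin> \<int>\<^sub>\<le>\<^sub>0"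
    and e: "e = a + 1 + of_nat M"
  shows "rGamma (1 - a) * rGamma (f - a) * rGamma (g - a) * rGamma (1 + a - b) * rGamma (1 + a - c) * rGamma (1 + a - d) *
      F43 a (1 + a - e) (1 + a - f) (1 + a - g) (1 + a - b) (1 + a - c) (1 + a - d) =
     rGamma (e - b) * rGamma (e - c) * rGamma (e - d) * rGamma (2 - e) * rGamma (1 + f - e) * rGamma (1 + g - e) *
      F43 (1 + a - e) (1 + b - e) (1 + c - e) (1 + d - e) (2 - e) (1 + f - e) (1 + g - e)"
proof -
  have M: "1 + a - e = - of_nat M" using e by simp
  have swap: "F43 a (1 + a - e) (1 + a - f) (1 + a - g) (1 + a - b) (1 + a - c) (1 + a - d) =
     F43 (- of_nat M) (1 - (1 - a)) (1 - (f - a)) (1 - (g - a)) (1 + a - b) (1 + a - c) (1 + a - d)"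
    unfolding M F43_def by (simp add: mult_ac algebra_simps)
  have eqs: "1 + b - e = 1 - (e - b)" "1 + c - e = 1 - (e - c)" "1 + d - e = 1 - (e - d)" by simp_all
  show ?thesis unfolding swap unfolding M eqs
    by ((subst terminating_F43, (rule assms)+)+,
        rule sum.reindex_bij_witness[of _ "\<lambda>n. M - n" "\<lambda>n. M - n"])
      (auto simp: e of_nat_diff binomial_symmetric[symmetric] algebra_simps)
qed

lemma F43_commute_lower: "F43 a b c d f e g = F43 a b c d e f g"
  by (simp add: F43_def mult_ac)

lemma F43_commute_upper: "F43 a c b d e f g = F43 a b c d e f g"
  by (simp add: F43_def mult_ac)

lemma Kfun_commute: "Kfun a b c d f e g = Kfun a b c d e f g"
  by (simp add: Kfun_def F43_commute_lower[of _ _ _ _ f e] F43_commute_upper[of _ "1 + a - f" "1 + a - e"] mult_ac)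

text \<open>By reflection the left side is \<open>- \<kappa>\<close> times the four-term relation;
  the coefficients are compared series by series in \<open>ca\<close>, \<open>ce\<close>,
  \<open>cf\<close> and \<open>c0\<close>.\<close>

lemma relation_generic:
  assumes V: "e + f + g - a - b - c - d = (1::complex)"
    and nonint: "a \<notin> \<int>" "e \<notin> \<int>" "f \<notin> \<int>" "f - e \<notin> \<int>" "e - a \<notin> \<int>" "f - a \<notin> \<int>"
    and S: "sin (of_real pi * a) \<noteq> 0" "sin (of_real pi * e) \<noteq> 0" "sin (of_real pi * f) \<noteq> 0"
    and lower: "g \<notin> \<int>\<^sub>\<le>\<^sub>0" "1 + g - e \<notin> \<int>\<^sub>\<le>\<^sub>0" "1 + g - f \<notin> \<int>\<^sub>\<le>\<^sub>0"
      "1 + a - b \<notin> \<int>\<^sub>\<le>\<^sub>0" "1 + a - c \<notin> \<int>\<^sub>\<le>\<^sub>0" "1 + a - d \<notin> \<int>\<^sub>\<le>\<^sub>0"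
  shows "Sprod [f - e] * Aprod (1 - a) (e - a) (f - a) (g - a) * Kfun a b c d e f g
       + Sprod [f - a] * Aprod (e - a) (e - b) (e - c) (e - d) * Lfun a b c d e f g
       - Sprod [e - a] * Aprod (f - a) (f - b) (f - c) (f - d) * Lfun a b c d f e g = 0"
proof -
  define w :: complex where "w = of_real pi"
  have w: "w \<noteq> 0" by (simp add: w_def)
  \<comment> \<open>The factor left over in \<open>ca\<close> when \<open>rGamma (1 - a)\<close>,
    \<open>rGamma (e - a)\<close> and \<open>rGamma (f - a)\<close> are reflected; the other
    coefficients share it.\<close>
  define \<kappa> where "\<kappa> = sin (w * (f - e)) * sin (w * (e - a)) * sin (w * (f - a)) / w ^ 3 *
      (rGamma a * rGamma b * rGamma c * rGamma d)"
  have refl: "rGamma x * rGamma y = sin (w * x) / w" if "x + y = 1" for x y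
  proof -
    have "y = 1 - x" using that by (simp add: algebra_simps)
    then show ?thesis using rGamma_reflection_complex[of x] by (simp add: w_def)
  qed
  have sin1: "sin (w * (1 + x)) = - sin (w * x)" for x
    by (simp add: w_def algebra_simps sin_add flip: sin_of_real cos_of_real)
  have sin2: "sin (w * (2 - x)) = - sin (w * x)" for x
    using sin1[of "1 - x"] sin1[of "- x"] by (simp add: algebra_simps)
  have nz: "rGamma x \<noteq> 0" if "x \<notin> \<int>" for x :: complex
    using that nonpos_Ints_Int by (auto simp: rGamma_eq_zero_iff)
  have shift: "of_int k - x \<notin> \<int>" "of_int k + x \<notin> \<int>" if "x \<notin> \<int>" for x :: complex and k
    using that by (metis Ints_diff Ints_of_int add_diff_cancel_left' diff_diff_eq2)+
  have nzs: "rGamma a \<noteq> 0" "rGamma e \<noteq> 0" "rGamma f \<noteq> 0" "rGamma (1 - e) \<noteq> 0" "rGamma (1 - f) \<noteq> 0" "rGamma (e - 1) \<noteq> 0"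
    "rGamma (f - 1) \<noteq> 0" "rGamma (e - f) \<noteq> 0" "rGamma (f - e) \<noteq> 0" "rGamma (1 + a - e) \<noteq> 0" "rGamma (1 + a - f) \<noteq> 0"
    using nonint nonint[THEN shift(1)[where k = 1]] nonint[THEN shift(1)[where k = 0]] nonint[THEN shift(2)[where k = "-1"]]
    by (auto intro!: nz simp: algebra_simps)
  have r: "rGamma (1 - a) = sin (w * a) / w / rGamma a"
      "rGamma (e - a) = sin (w * (e - a)) / w / rGamma (1 + a - e)"
      "rGamma (f - a) = sin (w * (f - a)) / w / rGamma (1 + a - f)"
      "rGamma (2 - e) = - sin (w * e) / w / rGamma (e - 1)"
      "rGamma (2 - f) = - sin (w * f) / w / rGamma (f - 1)"
      "rGamma (1 + f - e) = - sin (w * (f - e)) / w / rGamma (e - f)"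
      "rGamma (1 + e - f) = sin (w * (f - e)) / w / rGamma (f - e)"
      "rGamma (1 - e) = sin (w * e) / w / rGamma e"
      "rGamma (1 - f) = sin (w * f) / w / rGamma f"
  proof -
    have q: "rGamma x = sin (w * x) / w / rGamma y" if "x + y = 1" "rGamma y \<noteq> 0" for x y
      using refl[OF that(1)] that(2) w by (simp add: field_simps)
    have q': "rGamma y = sin (w * x) / w / rGamma x" if "x + y = 1" "rGamma x \<noteq> 0" for x y
      using refl[OF that(1)] that(2) w by (simp add: field_simps)
    show "rGamma (1 - a) = sin (w * a) / w / rGamma a"
      "rGamma (1 + e - f) = sin (w * (f - e)) / w / rGamma (f - e)"
      "rGamma (1 - e) = sin (w * e) / w / rGamma e"
      "rGamma (1 - f) = sin (w * f) / w / rGamma f"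
      by (rule q'; use nzs in simp)+
    show "rGamma (e - a) = sin (w * (e - a)) / w / rGamma (1 + a - e)"
      "rGamma (f - a) = sin (w * (f - a)) / w / rGamma (1 + a - f)"
      by (rule q; use nzs in simp)+
    show "rGamma (2 - e) = - sin (w * e) / w / rGamma (e - 1)"
      "rGamma (2 - f) = - sin (w * f) / w / rGamma (f - 1)"
      unfolding sin2[symmetric] by (rule q; use nzs in simp)+
    have shift: "1 + f - e = 1 + (f - e)" by simp
    show "rGamma (1 + f - e) = - sin (w * (f - e)) / w / rGamma (e - f)"
      unfolding sin1[symmetric] shift by (rule q; use nzs in simp)
  qed
  define xa where "xa = (rGamma (g - a) * rGamma (1 + a - b) * rGamma (1 + a - c) * rGamma (1 + a - d)) /
           (rGamma a * rGamma (1 + a - e) * rGamma (1 + a - f))"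
  define x0 where "x0 = (rGamma (1 - b) * rGamma (1 - c) * rGamma (1 - d) * rGamma g) /
           (rGamma (1 - e) * rGamma (1 - f) * rGamma a)"
  define xe where "xe = (rGamma (e - b) * rGamma (e - c) * rGamma (e - d) * rGamma (1 + g - e)) /
           (rGamma (e - 1) * rGamma (e - f) * rGamma (1 + a - e))"
  define xf where "xf = (rGamma (f - b) * rGamma (f - c) * rGamma (f - d) * rGamma (1 + g - f)) /
           (rGamma (f - 1) * rGamma (f - e) * rGamma (1 + a - f))"
  have S': "sin (w * a) \<noteq> 0" "sin (w * e) \<noteq> 0" "sin (w * f) \<noteq> 0" using S by (simp_all add: w_def)
  have ca: "sin (w * (f - e)) * (rGamma (1 - a) * rGamma (e - a) * rGamma (f - a) * rGamma (g - a)) *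
      (rGamma a * rGamma b * rGamma c * rGamma d * rGamma (1 + a - b) * rGamma (1 + a - c) * rGamma (1 + a - d)) /
      sin (w * a) = \<kappa> * xa"
  proof -
    \<comment> \<open>Once reflection is applied, only field arithmetic remains; it is done with
      variables in place of the sines and \<open>rGamma\<close> values.\<close>
    have "s1 * ((sa / w / ra) * (s2 / w / r1) * (s3 / w / r2) * rga) * (ra * rb * rc * rd * q1 * q2 * q3) / sa =
        s1 * s2 * s3 / w ^ 3 * (ra * rb * rc * rd) * ((rga * q1 * q2 * q3) / (ra * r1 * r2))"
      if "sa \<noteq> 0" "ra \<noteq> 0" "r1 \<noteq> 0" "r2 \<noteq> 0" for s1 s2 s3 sa ra r1 r2 rga rb rc rd q1 q2 q3 :: complex
      using that w by (simp add: field_simps power3_eq_cube)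
    then show ?thesis unfolding r \<kappa>_def xa_def using S' nzs by blast
  qed
  have ce: "sin (w * (f - a)) * (rGamma (e - a) * rGamma (e - b) * rGamma (e - c) * rGamma (e - d)) *
      (rGamma a * rGamma b * rGamma c * rGamma d * rGamma (2 - e) * rGamma (1 + f - e) * rGamma (1 + g - e)) /
      sin (w * e) = \<kappa> * xe"
  proof -
    have "s3 * ((s2 / w / r1) * q1 * q2 * q3) * (ra * rb * rc * rd * (- se / w / r2) * (- s1 / w / r3) * q4) / se =
        s1 * s2 * s3 / w ^ 3 * (ra * rb * rc * rd) * ((q1 * q2 * q3 * q4) / (r2 * r3 * r1))"
      if "se \<noteq> 0" "r1 \<noteq> 0" "r2 \<noteq> 0" "r3 \<noteq> 0" for s1 s2 s3 se ra r1 r2 r3 rb rc rd q1 q2 q3 q4 :: complex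
      using that w by (simp add: field_simps power3_eq_cube)
    then show ?thesis unfolding r \<kappa>_def xe_def using S' nzs by blast
  qed
  have cf: "sin (w * (e - a)) * (rGamma (f - a) * rGamma (f - b) * rGamma (f - c) * rGamma (f - d)) *
      (rGamma a * rGamma b * rGamma c * rGamma d * rGamma (2 - f) * rGamma (1 + e - f) * rGamma (1 + g - f)) /
      sin (w * f) = - (\<kappa> * xf)"
  proof -
    have "s2 * ((s3 / w / r1) * q1 * q2 * q3) * (ra * rb * rc * rd * (- se / w / r2) * (s1 / w / r3) * q4) / se =
        - (s1 * s2 * s3 / w ^ 3 * (ra * rb * rc * rd) * ((q1 * q2 * q3 * q4) / (r2 * r3 * r1)))"
      if "se \<noteq> 0" "r1 \<noteq> 0" "r2 \<noteq> 0" "r3 \<noteq> 0" for s1 s2 s3 se ra r1 r2 r3 rb rc rd q1 q2 q3 q4 :: complex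
      using that w by (simp add: field_simps power3_eq_cube)
    then show ?thesis unfolding r \<kappa>_def xf_def using S' nzs by blast
  qed
  have c0: "sin (w * (f - e)) * (rGamma (1 - a) * rGamma (e - a) * rGamma (f - a) * rGamma (g - a)) *
       (rGamma a * rGamma (1 + a - e) * rGamma (1 + a - f) * rGamma (1 + a - g) * rGamma e * rGamma f * rGamma g) /
       sin (w * a)
     + sin (w * (f - a)) * (rGamma (e - a) * rGamma (e - b) * rGamma (e - c) * rGamma (e - d)) *
       (rGamma (1 + a - e) * rGamma (1 + b - e) * rGamma (1 + c - e) * rGamma (1 + d - e) *
        rGamma e * rGamma f * rGamma g) / sin (w * e)
     - sin (w * (e - a)) * (rGamma (f - a) * rGamma (f - b) * rGamma (f - c) * rGamma (f - d)) *
       (rGamma (1 + a - f) * rGamma (1 + b - f) * rGamma (1 + c - f) * rGamma (1 + d - f) *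
        rGamma f * rGamma e * rGamma g) / sin (w * f) = - (\<kappa> * x0)" (is "?A + ?B - ?C = _")
  proof -
    define G where "G = rGamma e * rGamma f * rGamma g"
    have "?A = sin (w * (f - e)) * (rGamma a * rGamma (1 - a)) * (rGamma (e - a) * rGamma (1 + a - e)) *
         (rGamma (f - a) * rGamma (1 + a - f)) * (rGamma (g - a) * rGamma (1 + a - g)) * G / sin (w * a)"
      by (simp add: G_def mult_ac)
    also have "\<dots> = sin (w * (f - e)) * (sin (w * a) / w) * (sin (w * (e - a)) / w) *
         (sin (w * (f - a)) / w) * (sin (w * (g - a)) / w) * G / sin (w * a)"
      by (subst (1 2 3 4) refl) auto
    also have "\<dots> = G * sin (w * (e - a)) * sin (w * (f - a)) / w ^ 4 * (sin (w * (f - e)) * sin (w * (g - a)))"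
      using S' w by (simp add: power4_eq_xxxx mult_ac)
    finally have A: "?A = G * sin (w * (e - a)) * sin (w * (f - a)) / w ^ 4 * (sin (w * (f - e)) * sin (w * (g - a)))" .
    have "?B = sin (w * (f - a)) * (rGamma (e - a) * rGamma (1 + a - e)) * (rGamma (e - b) * rGamma (1 + b - e)) *
         (rGamma (e - c) * rGamma (1 + c - e)) * (rGamma (e - d) * rGamma (1 + d - e)) * G / sin (w * e)"
      by (simp add: G_def mult_ac)
    also have "\<dots> = sin (w * (f - a)) * (sin (w * (e - a)) / w) * (sin (w * (e - b)) / w) *
         (sin (w * (e - c)) / w) * (sin (w * (e - d)) / w) * G / sin (w * e)"
      by (subst (1 2 3 4) refl) auto
    finally have B: "?B = G * sin (w * (e - a)) * sin (w * (f - a)) / w ^ 4 *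
         (sin (w * (e - b)) * sin (w * (e - c)) * sin (w * (e - d)) / sin (w * e))"
      by (simp add: power4_eq_xxxx mult_ac)
    have "?C = sin (w * (e - a)) * (rGamma (f - a) * rGamma (1 + a - f)) * (rGamma (f - b) * rGamma (1 + b - f)) *
         (rGamma (f - c) * rGamma (1 + c - f)) * (rGamma (f - d) * rGamma (1 + d - f)) * G / sin (w * f)"
      by (simp add: G_def mult_ac)
    also have "\<dots> = sin (w * (e - a)) * (sin (w * (f - a)) / w) * (sin (w * (f - b)) / w) *
         (sin (w * (f - c)) / w) * (sin (w * (f - d)) / w) * G / sin (w * f)"
      by (subst (1 2 3 4) refl) auto
    finally have C: "?C = G * sin (w * (e - a)) * sin (w * (f - a)) / w ^ 4 *
         (sin (w * (f - b)) * sin (w * (f - c)) * sin (w * (f - d)) / sin (w * f))"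
      by (simp add: power4_eq_xxxx mult_ac)
    \<comment> \<open>The excess condition removes \<open>g\<close> and \<open>a\<close> from this
      sine, as required for \<open>sin_product_identity\<close>.\<close>
    have arg: "g - a = 1 + - (e + f - b - c - d)"
      using V by (simp add: algebra_simps)
    have sg: "sin (w * (g - a)) = sin (w * e + w * f - w * b - w * c - w * d)"
      unfolding arg sin1 by (simp add: algebra_simps flip: sin_minus)
    have quot: "X * X' + y * y' * y'' / se - z * z' * z'' / sf = - (X * (s * s' * s'') / (se * sf))"
      if "X * X' * se * sf + sf * y * y' * y'' - se * z * z' * z'' = - (X * s * s' * s'')" "se \<noteq> 0" "sf \<noteq> 0"
      for X X' se sf y y' y'' z z' z'' s s' s'' :: complex
    proof -
      have "X * X' + y * y' * y'' / se - z * z' * z'' / sf =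
          (X * X' * se * sf + sf * y * y' * y'' - se * z * z' * z'') / (se * sf)"
        using that(2,3) by (simp add: field_simps)
      then show ?thesis unfolding that(1) by (simp add: mult_ac)
    qed
    have "sin (w * (f - e)) * sin (w * (g - a)) * sin (w * e) * sin (w * f)
       + sin (w * f) * sin (w * (e - b)) * sin (w * (e - c)) * sin (w * (e - d))
       - sin (w * e) * sin (w * (f - b)) * sin (w * (f - c)) * sin (w * (f - d))
       = - (sin (w * (f - e)) * sin (w * b) * sin (w * c) * sin (w * d))"
      unfolding sg unfolding right_diff_distrib by (rule sin_product_identity)
    then have trig: "sin (w * (f - e)) * sin (w * (g - a))
       + sin (w * (e - b)) * sin (w * (e - c)) * sin (w * (e - d)) / sin (w * e)
       - sin (w * (f - b)) * sin (w * (f - c)) * sin (w * (f - d)) / sin (w * f)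
       = - (sin (w * (f - e)) * (sin (w * b) * sin (w * c) * sin (w * d)) / (sin (w * e) * sin (w * f)))"
      using S' by (intro quot)
    have "?A + ?B - ?C = G * sin (w * (e - a)) * sin (w * (f - a)) / w ^ 4 *
       - (sin (w * (f - e)) * (sin (w * b) * sin (w * c) * sin (w * d)) / (sin (w * e) * sin (w * f)))"
      unfolding A B C trig[symmetric] by (simp only: distrib_left right_diff_distrib)
    \<comment> \<open>Powers of \<open>w\<close> are redistributed so that each sine of
      \<open>b\<close>, \<open>c\<close>, \<open>d\<close> can be turned back into a reflection
      product.\<close>
    also have "\<dots> = - (sin (w * (f - e)) * sin (w * (e - a)) * sin (w * (f - a)) / w ^ 3 *
        ((sin (w * b) / w) * (sin (w * c) / w) * (sin (w * d) / w) * (w / sin (w * e)) * (w / sin (w * f)) * G))"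
      using S' w by (simp add: field_simps power3_eq_cube power4_eq_xxxx)
    also have "\<dots> = - (sin (w * (f - e)) * sin (w * (e - a)) * sin (w * (f - a)) / w ^ 3 *
        ((rGamma b * rGamma (1 - b)) * (rGamma c * rGamma (1 - c)) * (rGamma d * rGamma (1 - d)) *
         (w / sin (w * e)) * (w / sin (w * f)) * G))"
      by (subst (1 2 3) refl) auto
    also have "\<dots> = - (\<kappa> * x0)"
      unfolding \<kappa>_def x0_def G_def r(8,9) using nzs by simp
    finally show ?thesis .
  qed
  have expand: "s1 * A1 * (F0 * k1 / sa + Fa * k2 / sa) + s2 * A2 * (F0 * k3 / se - Fe * k4 / se)
      - s3 * A3 * (F0 * k5 / sf - Ff * k6 / sf) =
      (s1 * A1 * k1 / sa + s2 * A2 * k3 / se - s3 * A3 * k5 / sf) * F0 + (s1 * A1 * k2 / sa) * Fa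
      - (s2 * A2 * k4 / se) * Fe + (s3 * A3 * k6 / sf) * Ff"
    for s1 A1 F0 k1 sa Fa k2 s2 A2 k3 se Fe k4 s3 A3 k5 sf Ff k6 :: complex
    by (simp add: algebra_simps)
  have zero: "x0 * F43 a b c d e f g
       + xe * F43 (1 + a - e) (1 + b - e) (1 + c - e) (1 + d - e) (2 - e) (1 + f - e) (1 + g - e)
       + xf * F43 (1 + a - f) (1 + b - f) (1 + c - f) (1 + d - f) (2 - f) (1 + e - f) (1 + g - f)
       - xa * F43 a (1 + a - e) (1 + a - f) (1 + a - g) (1 + a - b) (1 + a - c) (1 + a - d) = 0"
    unfolding x0_def xe_def xf_def xa_def using V nonint lower by (rule four_term_relation)
  have "Sprod [f - e] * Aprod (1 - a) (e - a) (f - a) (g - a) * Kfun a b c d e f g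
       + Sprod [f - a] * Aprod (e - a) (e - b) (e - c) (e - d) * Lfun a b c d e f g
       - Sprod [e - a] * Aprod (f - a) (f - b) (f - c) (f - d) * Lfun a b c d f e g =
     - (\<kappa> * x0) * F43 a b c d e f g + (\<kappa> * xa) * F43 a (1 + a - e) (1 + a - f) (1 + a - g) (1 + a - b) (1 + a - c) (1 + a - d)
     - (\<kappa> * xe) * F43 (1 + a - e) (1 + b - e) (1 + c - e) (1 + d - e) (2 - e) (1 + f - e) (1 + g - e)
     + - (\<kappa> * xf) * F43 (1 + a - f) (1 + b - f) (1 + c - f) (1 + d - f) (2 - f) (1 + e - f) (1 + g - f)"
    unfolding Aprod_def Kfun_def Lfun_def F43_commute_lower[of a b c d f e g] w_def[symmetric]
    by (simp only: Sprod_def list.map prod_list.Cons prod_list.Nil mult_1_right w_def[symmetric] expand ca ce cf c0)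
  also have "\<dots> = - \<kappa> * (x0 * F43 a b c d e f g
       + xe * F43 (1 + a - e) (1 + b - e) (1 + c - e) (1 + d - e) (2 - e) (1 + f - e) (1 + g - e)
       + xf * F43 (1 + a - f) (1 + b - f) (1 + c - f) (1 + d - f) (2 - f) (1 + e - f) (1 + g - f)
       - xa * F43 a (1 + a - e) (1 + a - f) (1 + a - g) (1 + a - b) (1 + a - c) (1 + a - d))"
    by (simp add: ring_distribs mult.assoc)
  finally show ?thesis unfolding zero by simp
qed

text \<open>If \<open>e - a\<close> is a nonpositive integer, all three terms vanish. If it is
  positive, \<open>sin (pi * (e - a))\<close> removes the last term and
  \<open>rGamma (1 + a - e) = 0\<close> removes \<open>F43 a b c d e f g\<close>; the two remaining
  series terminate and cancel by reversal.\<close>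

lemma relation_terminating:
  assumes K: "K_defined a b c d e f g" and L: "L_defined a b c d e f g" and int: "e - a \<in> \<int>"
  shows "Sprod [f - e] * Aprod (1 - a) (e - a) (f - a) (g - a) * Kfun a b c d e f g
       + Sprod [f - a] * Aprod (e - a) (e - b) (e - c) (e - d) * Lfun a b c d e f g
       - Sprod [e - a] * Aprod (f - a) (f - b) (f - c) (f - d) * Lfun a b c d f e g = 0"
proof (cases "e - a \<in> \<int>\<^sub>\<le>\<^sub>0")
  case True
  then show ?thesis
    using sin_pi_Ints[OF int] by (simp add: Sprod_def Aprod_def rGamma_nonpos_Int)
next
  case False
  obtain m where m: "e - a = of_int m" using int by (elim Ints_cases)
  have "m > 0" using False m by (metis nonpos_Ints_of_int not_le)
  define M where "M = nat (m - 1)"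
  have "m = 1 + int M" using \<open>m > 0\<close> by (simp add: M_def)
  then have e: "e = a + 1 + of_nat M" using m by (simp add: algebra_simps)
  define w :: complex where "w = of_real pi"
  have S: "sin (w * a) \<noteq> 0" "sin (w * e) \<noteq> 0"
    using K L by (auto simp: K_defined_def L_defined_def w_def)
  have h0: "sin (w * (e - a)) = 0" using sin_pi_Ints[OF int] by (simp add: w_def)
  have "cos (w * (e - a)) * cos (w * (e - a)) = 1"
    using sin_cos_squared_add[of "w * (e - a)"] h0 by (simp add: power2_eq_square)
  moreover have "sin (w * (f - e)) = sin (w * (f - a)) * cos (w * (e - a))"
    using sin_diff[of "w * (f - a)" "w * (e - a)"] h0 by (simp add: algebra_simps)
  moreover have "sin (w * e) = sin (w * a) * cos (w * (e - a))"
    using sin_add[of "w * a" "w * (e - a)"] h0 by (simp add: algebra_simps)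
  \<comment> \<open>A shift by \<open>pi * (e - a)\<close> multiplies both sines by the same sign
    \<open>cos (w * (e - a))\<close>.\<close>
  ultimately have sc: "sin (w * (f - e)) / sin (w * a) = sin (w * (f - a)) / sin (w * e)"
    using S by (simp add: field_simps)
  have r0: "rGamma (1 + a - e) = 0" by (simp add: e)
  have rev: "rGamma (1 - a) * rGamma (f - a) * rGamma (g - a) * rGamma (1 + a - b) * rGamma (1 + a - c) * rGamma (1 + a - d) *
      F43 a (1 + a - e) (1 + a - f) (1 + a - g) (1 + a - b) (1 + a - c) (1 + a - d) =
     rGamma (e - b) * rGamma (e - c) * rGamma (e - d) * rGamma (2 - e) * rGamma (1 + f - e) * rGamma (1 + g - e) *
      F43 (1 + a - e) (1 + b - e) (1 + c - e) (1 + d - e) (2 - e) (1 + f - e) (1 + g - e)"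
    using K L e by (intro terminating_F43_reverse) (auto simp: K_defined_def L_defined_def)
  have comb: "s1 * (r1 * r2 * r3 * r4) * (Fa * (ra * rb * rc * rd * q1 * q2 * q3) / sa) -
      s2 * (r2 * p1 * p2 * p3) * (Fe * (ra * rb * rc * rd * t1 * t2 * t3) / se) = 0"
    if "s1 / sa = s2 / se" "r1 * r3 * r4 * q1 * q2 * q3 * Fa = p1 * p2 * p3 * t1 * t2 * t3 * Fe"
    for s1 r1 r2 r3 r4 Fa ra rb rc rd q1 q2 q3 sa s2 p1 p2 p3 Fe t1 t2 t3 se :: complex
  proof -
    have "s1 * (r1 * r2 * r3 * r4) * (Fa * (ra * rb * rc * rd * q1 * q2 * q3) / sa) =
        (s1 / sa) * (r2 * (ra * rb * rc * rd)) * (r1 * r3 * r4 * q1 * q2 * q3 * Fa)" by (simp add: mult_ac)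
    also have "\<dots> = s2 * (r2 * p1 * p2 * p3) * (Fe * (ra * rb * rc * rd * t1 * t2 * t3) / se)"
      unfolding that by (simp add: mult_ac)
    finally show ?thesis by simp
  qed
  have Kf: "Kfun a b c d e f g = F43 a (1 + a - e) (1 + a - f) (1 + a - g) (1 + a - b) (1 + a - c) (1 + a - d) *
       (rGamma a * rGamma b * rGamma c * rGamma d *
        rGamma (1 + a - b) * rGamma (1 + a - c) * rGamma (1 + a - d)) / sin (w * a)"
    unfolding Kfun_def r0 w_def by simp
  have Lf: "Lfun a b c d e f g = - (F43 (1 + a - e) (1 + b - e) (1 + c - e) (1 + d - e) (2 - e) (1 + f - e) (1 + g - e) *
       (rGamma a * rGamma b * rGamma c * rGamma d *
        rGamma (2 - e) * rGamma (1 + f - e) * rGamma (1 + g - e)) / sin (w * e))"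
    unfolding Lfun_def r0 w_def by simp
  show ?thesis
    unfolding Sprod_def Aprod_def Kf Lf using comb[OF sc rev] h0 by (simp add: w_def)
qed

theorem proposition6p2:
  fixes x :: "complex^7" and a b c d e f g :: complex
  assumes "x \<in> V"
    and "a = x$1" "b = x$2" "c = x$3" "d = x$4" "e = x$5" "f = x$6" "g = x$7"
    and "K_defined a b c d e f g"
    and "L_defined a b c d e f g"
    and "L_defined a b c d f e g"
  shows "Sprod [f - e] * Aprod (1 - a) (e - a) (f - a) (g - a) * K_p0 x
       + Sprod [f - a] * Aprod (e - a) (e - b) (e - c) (e - d) * L6 x
       - Sprod [e - a] * Aprod (f - a) (f - b) (f - c) (f - d) * L5 x = 0"
proof -
  have V: "e + f + g - a - b - c - d = 1"
    using assms(1-8) by (simp add: V_def)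
  have KL: "K_p0 x = Kfun a b c d e f g" "L6 x = Lfun a b c d e f g" "L5 x = Lfun a b c d f e g"
    using assms(2-8) by (simp_all add: K_p0_def L6_def L5_def)
  have K: "K_defined a b c d f e g"
    using assms(9) by (auto simp: K_defined_def)
  have S: "sin (of_real pi * a) \<noteq> 0" "sin (of_real pi * e) \<noteq> 0" "sin (of_real pi * f) \<noteq> 0"
    using assms(9-11) by (auto simp: K_defined_def L_defined_def)
  consider "e = f" | "e - a \<in> \<int>" | "f - a \<in> \<int>" | "e \<noteq> f" "e - a \<notin> \<int>" "f - a \<notin> \<int>" by blast
  then show ?thesis
  proof cases
    case 1
    \<comment> \<open>The first sine is \<open>sin 0\<close>, and the two \<open>Lfun\<close> terms
      coincide and cancel.\<close>
    then show ?thesis unfolding KL by (simp add: Sprod_def)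
  next
    case 2
    then show ?thesis unfolding KL using assms relation_terminating by blast
  next
    case 3
    \<comment> \<open>Exchanging \<open>e\<close> and \<open>f\<close> fixes \<open>Kfun\<close>,
      swaps the two \<open>Lfun\<close> terms and negates the whole relation.\<close>
    have "Sprod [e - f] * Aprod (1 - a) (f - a) (e - a) (g - a) * Kfun a b c d f e g
       + Sprod [e - a] * Aprod (f - a) (f - b) (f - c) (f - d) * Lfun a b c d f e g
       - Sprod [f - a] * Aprod (e - a) (e - b) (e - c) (e - d) * Lfun a b c d e f g = 0"
      using K assms(11) 3 by (rule relation_terminating)
    moreover have "Sprod [e - f] = - Sprod [f - e]"
      using sin_minus[of "of_real pi * (f - e)"] by (simp add: Sprod_def algebra_simps)
    moreover have "Aprod (1 - a) (f - a) (e - a) (g - a) = Aprod (1 - a) (e - a) (f - a) (g - a)"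
      by (simp add: Aprod_def mult_ac)
    ultimately show ?thesis
      unfolding KL Kfun_commute[of a b c d f e g] by (simp add: algebra_simps)
  next
    case 4
    \<comment> \<open>For a nonzero integral \<open>f - e\<close> one of \<open>1 + f - e\<close>
      and \<open>1 + e - f\<close> is a nonpositive integer, yet both are lower parameters of the
      \<open>Lfun\<close> series.\<close>
    have "f - e \<notin> \<int>"
    proof
      assume "f - e \<in> \<int>"
      then obtain k where k: "f - e = of_int k" by (elim Ints_cases)
      then have "k \<noteq> 0" using 4 by auto
      then have "1 + k \<le> 0 \<or> 1 - k \<le> 0" by linarith
      moreover have "1 + f - e = of_int (1 + k)" "1 + e - f = of_int (1 - k)"
        using k by (simp_all add: algebra_simps)
      moreover have "1 + f - e \<notin> \<int>\<^sub>\<le>\<^sub>0" "1 + e - f \<notin> \<int>\<^sub>\<le>\<^sub>0"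
        using assms(10,11) by (auto simp: L_defined_def)
      ultimately show False by (metis nonpos_Ints_of_int)
    qed
    moreover have "a \<notin> \<int>" "e \<notin> \<int>" "f \<notin> \<int>" using S sin_pi_Ints by blast+
    ultimately show ?thesis
      unfolding KL using V S 4 assms(9-11)
      by (intro relation_generic) (auto simp: K_defined_def L_defined_def)
  qed
qed

end
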